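(* Let $(X_1^{(1)},\ldots,X_{k_1}^{(1)};\ldots;X_1^{(n)},\ldots,X_{k_n}^{(n)})\sim SME_\zeta(\boldsymbol{\beta},\underline{\boldsymbol{Q}},\boldsymbol{\alpha})$ with $\gamma_j^{(i)}<\infty$ and $\beta_{k_n}^{(n)}\ge\beta_j^{(i)}$, $j=1,\ldots,k_i$, and let $d_i>0$, for $i\in I_n$. Let $S_i=\sum_{j=1}^{k_i}X_j^{(i)}$, $\boldsymbol{S}=(S_1,\ldots,S_n)$, $\boldsymbol{d}=(d_1,\ldots,d_n)$, $T_i=(S_i-d_i)_+$ and $R_n=\sum_{i=1}^nT_i$. Then the distribution function of $R_n$ is given, for $y\ge0$, by $$\begin{aligned}F_{R_n}(y)=F_{\boldsymbol{S}}(\boldsymbol{d})+\sum_{k=1}^n\ \sum_{1\le j_1<\cdots<j_k\le n}\Big[&\xi_nH_{S_{j_1}^{(1)}+\cdots+S_{j_k}^{(1)}}(y,d_{j_1},\ldots,d_{j_k})\prod_{i\in I_n\setminus\{j_1,\ldots,j_k\}}F_{S_i^{(1)}}(d_i)\\ &-\sum_{1\le a\le b\le n}\sum_{s=1}^{k_a}\sum_{t=T(s,a,b)}^{k_b}\alpha_{s,t}^{(a,b)}\gamma_s^{(a)}\gamma_t^{(b)}\Big(H_{S_{j_1;s}^{(2;a)}+\cdots+S_{j_k;s}^{(2;a)}}(y,d_{j_1},\ldots,d_{j_k})\prod_{i\in I_n\setminus\{j_1,\ldots,j_k\}}F_{S_{i;s}^{(2;a)}}(d_i)\\ &\quad+H_{S_{j_1;t}^{(2;b)}+\cdots+S_{j_k;t}^{(2;b)}}(y,d_{j_1},\ldots,d_{j_k})\prod_{i\in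 I_n\setminus\{j_1,\ldots,j_k\}}F_{S_{i;t}^{(2;b)}}(d_i)\\ &\quad-H_{S_{j_1;s,t}^{(3;a,b)}+\cdots+S_{j_k;s,t}^{(3;a,b)}}(y,d_{j_1},\ldots,d_{j_k})\prod_{i\in I_n\setminus\{j_1,\ldots,j_k\}}F_{S_{i;s,t}^{(3;a,b)}}(d_i)\Big)\Big].\end{aligned}$$
   Context: Mixed Erlang: for $\beta>0$, $k\ge1$, $w_k(x,\beta)=\frac{\beta^kx^{k-1}e^{-\beta x}}{(k-1)!}$, $x\ge0$, and $W_k(x,\beta)=1-e^{-\beta x}\sum_{j=0}^{k-1}\frac{(\beta x)^j}{j!}$. $ME(\beta,\underline{Q})$, with $\underline{Q}=(q_1,q_2,\ldots)$, $q_k\ge0$, $\sum_kq_k=1$, is the distribution on $[0,\infty)$ with pdf $\sum_{k\ge1}q_kw_k(x,\beta)$. $F_Z$ is the (joint) distribution function of $Z$; $I_n=\{1,\ldots,n\}$; empty products equal $1$, empty sums equal $0$. Model $SME_\zeta(\boldsymbol{\beta},\underline{\boldsymbol{Q}},\boldsymbol{\alpha})$: $n\ge 1$, $k_1,\ldots,k_n\ge1$ are integers, $\zeta=\sum_{i=1}^nk_i$, $\boldsymbol\beta=(\beta_j^{(i)})$, $\underline{\boldsymbol{Q}}=(\underline{Q}_j^{(i)})$, and $X_j^{(i)}\sim ME(\beta_j^{(i)},\underline{Q}_j^{(i)})$ with pdf $f_j^{(i)}$. Put $\gamma_j^{(i)}=\mathbb{E}(f_j^{(i)}(X_j^{(i)}))$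 and $\phi_j^{(i)}(x)=f_j^{(i)}(x)-\gamma_j^{(i)}$. The joint pdf is the Sarmanov density $$h(\boldsymbol{x})=\prod_{i=1}^n\prod_{j=1}^{k_i}f_j^{(i)}(x_j^{(i)})\Big[1+\sum_{1\le a<b\le n}\sum_{s=1}^{k_a}\sum_{t=1}^{k_b}\alpha_{s,t}^{(a,b)}\phi_s^{(a)}(x_s^{(a)})\phi_t^{(b)}(x_t^{(b)})+\sum_{a=1}^n\sum_{1\le s<t\le k_a}\alpha_{s,t}^{(a)}\phi_s^{(a)}(x_s^{(a)})\phi_t^{(a)}(x_t^{(a)})\Big],$$ where $\boldsymbol\alpha$ collects the real coefficients, which are such that the bracket is nonnegative. Write $\alpha_{s,t}^{(a,a)}=\alpha_{s,t}^{(a)}$, $T(s,a,b)=\max\{1,(s+1)\mathbb{1}_{(a=b)}\}$ ($\mathbb{1}_{(a=b)}$ is $1$ if $a=b$ and $0$ otherwise), and $$\xi_n=1+\sum_{1\le a\le b\le n}\sum_{s=1}^{k_a}\sum_{t=T(s,a,b)}^{k_b}\alpha_{s,t}^{(a,b)}\gamma_s^{(a)}\gamma_t^{(b)}.$$ Transformations of mixing vectors: - $V(\underline{Q})=(v_1,v_2,\ldots)$, $v_k=\dfrac{\sum_{i=1}^k\binom{k-1}{i-1}q_iq_{k+1-i}/2^k}{\sum_{i\ge1}\sum_{j\ge1}\binom{i+j-2}{i-1}q_iq_j/2^{i+j-1}}$; $V$ changes the associated scale parameter from $\beta$ to $2\beta$. - $\Psi(\underline{Q})=(\psi_1,\psi_2,\ldots)$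 converts a scale $\beta_1$ into a scale $\beta_2\ge\beta_1$: $\psi_k=\sum_{i=1}^kq_i\binom{k-1}{k-i}\big(\frac{\beta_1}{\beta_2}\big)^i\big(1-\frac{\beta_1}{\beta_2}\big)^{k-i}$ (with $0^0=1$). Here the target is always $\beta_2=2\beta_{k_n}^{(n)}$, and the source scale is $\beta_1=\beta_l^{(j)}$ when $\Psi$ is applied to $\underline{Q}_l^{(j)}$ and $\beta_1=2\beta_l^{(j)}$ when it is applied to $V(\underline{Q}_l^{(j)})$. - $\underline{\Pi}(\underline{Q}_1,\ldots,\underline{Q}_m)=(\pi_1,\pi_2,\ldots)$ is defined iteratively: $\underline{\Pi}(\underline{Q}_1)=\underline{Q}_1$, and $\pi_l(\underline{Q}_1,\ldots,\underline{Q}_{m+1})=0$ for $l=1,\ldots,m$, $\pi_l(\underline{Q}_1,\ldots,\underline{Q}_{m+1})=\sum_{j=m}^{l-1}\pi_j(\underline{Q}_1,\ldots,\underline{Q}_m)\,q_{m+1,l-j}$ for $l\ge m+1$, where $\underline{Q}_i=(q_{i,1},q_{i,2},\ldots)$. Auxiliary variables (only their distributions matter): with $M_{s,t}^{(a,b)}(\underline{Q}_l^{(j)})=V(\underline{Q}_l^{(j)})$ if $(j,l)\in\{(a,s),(b,t)\}$ and $=\underline{Q}_l^{(j)}$ otherwise, $$S_j^{(1)}\sim ME\big(2\beta_{k_n}^{(n)},\underline{\Pi}(\Psi(\underline{Q}_1^{(j)}),\ldots,\Psi(\underline{Q}_{k_j}^{(j)}))\big),\quad S_{j;s,t}^{(3;a,b)}\sim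 ME\big(2\beta_{k_n}^{(n)},\underline{\Pi}(\Psi(M_{s,t}^{(a,b)}(\underline{Q}_1^{(j)})),\ldots,\Psi(M_{s,t}^{(a,b)}(\underline{Q}_{k_j}^{(j)})))\big),\quad S_{j;s}^{(2;a)}=S_{j;s,s}^{(3;a,a)}.$$ The function $H$: for $Z_i\sim ME(\beta,\underline{P}_i)$, $i=1,\ldots,k$, with common scale $\beta$, and $d_1,\ldots,d_k>0$, $y\ge0$, $$H_{Z_1+\cdots+Z_k}(y,d_1,\ldots,d_k)=\sum_{h_1=0}^\infty\cdots\sum_{h_k=0}^\infty\Delta_{h_1}(d_1,\beta,\underline{P}_1)\cdots\Delta_{h_k}(d_k,\beta,\underline{P}_k)\,W_{\sum_{i=1}^kh_i+k}(y,\beta),$$ where $\Delta_k(d,\beta,\underline{Q})=\beta^{-1}\sum_{j=0}^\infty q_{j+k+1}w_{j+1}(d,\beta)$. (For independent $Z_i$ this is $\mathbb{P}(Z_i>d_i\ \forall i,\ \sum_i(Z_i-d_i)\le y)$.) *)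

theory Defs
  imports "HOL-Probability.Probability"
begin

section \<open>Mixed Erlang distributions\<close>

text \<open>
  A mixing vector \<open>(q\<^sub>1, q\<^sub>2, \<dots>)\<close> is a function \<open>q :: nat \<Rightarrow> real\<close> read at indices \<open>\<ge> 1\<close> only; the
  value \<open>q 0\<close> is never used. The Erlang density \<open>w\<^sub>k(x, \<beta>)\<close> is \<^term>\<open>erlang_density (k - 1) \<beta> x\<close>,
  and \<open>W\<^sub>k(x, \<beta>)\<close> is \<^term>\<open>erlang_CDF (k - 1) \<beta> x\<close>, for \<open>k \<ge> 1\<close>: the library indexes both
  by \<open>k - 1\<close>, and sets both to \<open>0\<close> for \<open>x < 0\<close>.
\<close>

definition mixing_vector :: "(nat \<Rightarrow> real) \<Rightarrow> bool" where
  "mixing_vector q \<longleftrightarrow> (\<forall>k\<ge>1. 0 \<le> q k) \<and> (\<lambda>k. q (Suc k)) sums 1"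

definition me_pdf :: "real \<Rightarrow> (nat \<Rightarrow> real) \<Rightarrow> real \<Rightarrow> real" where
  "me_pdf \<beta> q x = (\<Sum>k. q (Suc k) * erlang_density k \<beta> x)"

definition ME :: "real \<Rightarrow> (nat \<Rightarrow> real) \<Rightarrow> real measure" where
  "ME \<beta> q = density lborel (\<lambda>x. ennreal (me_pdf \<beta> q x))"

text \<open>\<open>\<gamma> = E(f(X))\<close> for \<open>X \<sim> ME(\<beta>, q)\<close> with density \<open>f\<close>.\<close>

definition me_gamma :: "real \<Rightarrow> (nat \<Rightarrow> real) \<Rightarrow> real" where
  "me_gamma \<beta> q = integral\<^sup>L (ME \<beta> q) (me_pdf \<beta> q)"

definition me_phi :: "real \<Rightarrow> (nat \<Rightarrow> real) \<Rightarrow> real \<Rightarrow> real" where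
  "me_phi \<beta> q x = me_pdf \<beta> q x - me_gamma \<beta> q"


section \<open>Transformations of mixing vectors\<close>

definition mix_V :: "(nat \<Rightarrow> real) \<Rightarrow> nat \<Rightarrow> real" where
  "mix_V q k =
     ((\<Sum>i=1..k. real ((k - 1) choose (i - 1)) * q i * q (k + 1 - i)) / 2 ^ k) /
     (\<Sum>i. \<Sum>j. real ((i + j) choose i) * q (Suc i) * q (Suc j) / 2 ^ (i + j + 1))"

text \<open>\<open>mix_Psi \<beta>\<^sub>1 \<beta>\<^sub>2 q\<close> converts the scale \<open>\<beta>\<^sub>1\<close> of \<open>q\<close> into \<open>\<beta>\<^sub>2 \<ge> \<beta>\<^sub>1\<close>.\<close>

definition mix_Psi :: "real \<Rightarrow> real \<Rightarrow> (nat \<Rightarrow> real) \<Rightarrow> nat \<Rightarrow> real" where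
  "mix_Psi \<beta>\<^sub>1 \<beta>\<^sub>2 q k =
     (\<Sum>i=1..k. q i * real ((k - 1) choose (k - i)) * (\<beta>\<^sub>1 / \<beta>\<^sub>2) ^ i * (1 - \<beta>\<^sub>1 / \<beta>\<^sub>2) ^ (k - i))"

text \<open>\<open>mix_Pi qs m = \<Pi>(qs 1, \<dots>, qs m)\<close> for \<open>m \<ge> 1\<close>; the value at \<open>m = 0\<close> is a dummy.\<close>

fun mix_Pi :: "(nat \<Rightarrow> nat \<Rightarrow> real) \<Rightarrow> nat \<Rightarrow> nat \<Rightarrow> real" where
  "mix_Pi qs 0 = (\<lambda>l. 0)"
| "mix_Pi qs (Suc 0) = qs 1"
| "mix_Pi qs (Suc (Suc m)) =
     (\<lambda>l. if l \<le> Suc m then 0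
          else (\<Sum>j=Suc m..l - 1. mix_Pi qs (Suc m) j * qs (Suc (Suc m)) (l - j)))"


section \<open>The function H\<close>

definition me_Delta :: "nat \<Rightarrow> real \<Rightarrow> real \<Rightarrow> (nat \<Rightarrow> real) \<Rightarrow> real" where
  "me_Delta k d \<beta> q = (1 / \<beta>) * (\<Sum>j. q (j + k + 1) * erlang_density j \<beta> d)"

text \<open>\<open>iterated_suminf k g = \<Sum>h\<^sub>1. \<dots> \<Sum>h\<^sub>k. g [h\<^sub>1, \<dots>, h\<^sub>k]\<close>\<close>

primrec iterated_suminf :: "nat \<Rightarrow> (nat list \<Rightarrow> real) \<Rightarrow> real" where
  "iterated_suminf 0 g = g []"
| "iterated_suminf (Suc k) g = (\<Sum>h. iterated_suminf k (\<lambda>hs. g (h # hs)))"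

text \<open>
  \<open>me_H \<beta> [P\<^sub>1, \<dots>, P\<^sub>k] y [d\<^sub>1, \<dots>, d\<^sub>k]\<close> is \<open>H(y, d\<^sub>1, \<dots>, d\<^sub>k)\<close> for \<open>Z\<^sub>1 + \<dots> + Z\<^sub>k\<close> with
  \<open>Z\<^sub>i \<sim> ME(\<beta>, P\<^sub>i)\<close>; it depends on the \<open>Z\<^sub>i\<close> through their parameters only.
\<close>

definition me_H :: "real \<Rightarrow> (nat \<Rightarrow> real) list \<Rightarrow> real \<Rightarrow> real list \<Rightarrow> real" where
  "me_H \<beta> Ps y ds =
     iterated_suminf (length Ps) (\<lambda>hs.
       (\<Prod>i<length Ps. me_Delta (hs ! i) (ds ! i) \<beta> (Ps ! i)) *
       erlang_CDF (sum_list hs + length Ps - 1) \<beta> y)"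


section \<open>The Sarmanov mixed Erlang model\<close>

text \<open>
  Parameters: \<open>n\<close>; block sizes \<open>k i\<close>; scales \<open>\<beta> i j\<close>; mixing vectors \<open>Q i j\<close>, for \<open>1 \<le> i \<le> n\<close>
  and \<open>1 \<le> j \<le> k i\<close> (upper index of the mathematical notation first); coefficients
  \<open>\<alpha> a b s t\<close> for \<open>a < b\<close> (between blocks) and \<open>\<alpha> a a s t\<close> for \<open>s < t\<close> (inside block \<open>a\<close>).
\<close>

definition sme_index :: "nat \<Rightarrow> (nat \<Rightarrow> nat) \<Rightarrow> (nat \<times> nat) set" where
  "sme_index n k = (SIGMA i:{1..n}. {1..k i})"

definition sme_bracket ::
  "nat \<Rightarrow> (nat \<Rightarrow> nat) \<Rightarrow> (nat \<Rightarrow> nat \<Rightarrow> real) \<Rightarrow> (nat \<Rightarrow> nat \<Rightarrow> nat \<Rightarrow> real) \<Rightarrow>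
   (nat \<Rightarrow> nat \<Rightarrow> nat \<Rightarrow> nat \<Rightarrow> real) \<Rightarrow> (nat \<times> nat \<Rightarrow> real) \<Rightarrow> real" where
  "sme_bracket n k \<beta> Q \<alpha> x =
     1 + (\<Sum>a=1..n. \<Sum>b=a+1..n. \<Sum>s=1..k a. \<Sum>t=1..k b.
            \<alpha> a b s t * me_phi (\<beta> a s) (Q a s) (x (a, s)) * me_phi (\<beta> b t) (Q b t) (x (b, t)))
       + (\<Sum>a=1..n. \<Sum>s=1..k a. \<Sum>t=s+1..k a.
            \<alpha> a a s t * me_phi (\<beta> a s) (Q a s) (x (a, s)) * me_phi (\<beta> a t) (Q a t) (x (a, t)))"

definition sme_pdf ::
  "nat \<Rightarrow> (nat \<Rightarrow> nat) \<Rightarrow> (nat \<Rightarrow> nat \<Rightarrow> real) \<Rightarrow> (nat \<Rightarrow> nat \<Rightarrow> nat \<Rightarrow> real) \<Rightarrow>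
   (nat \<Rightarrow> nat \<Rightarrow> nat \<Rightarrow> nat \<Rightarrow> real) \<Rightarrow> (nat \<times> nat \<Rightarrow> real) \<Rightarrow> real" where
  "sme_pdf n k \<beta> Q \<alpha> x =
     (\<Prod>i=1..n. \<Prod>j=1..k i. me_pdf (\<beta> i j) (Q i j) (x (i, j))) * sme_bracket n k \<beta> Q \<alpha> x"

text \<open>
  \<open>SME M n k \<beta> Q \<alpha> X\<close>: on the probability space \<open>M\<close>, the random variables \<open>X i j\<close> follow the
  model. Nonnegativity of the bracket is required on the support \<open>[0, \<infinity>)\<close> of the marginals.
\<close>

definition SME ::
  "'a measure \<Rightarrow> nat \<Rightarrow> (nat \<Rightarrow> nat) \<Rightarrow> (nat \<Rightarrow> nat \<Rightarrow> real) \<Rightarrow> (nat \<Rightarrow> nat \<Rightarrow> nat \<Rightarrow> real) \<Rightarrow>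
   (nat \<Rightarrow> nat \<Rightarrow> nat \<Rightarrow> nat \<Rightarrow> real) \<Rightarrow> (nat \<Rightarrow> nat \<Rightarrow> 'a \<Rightarrow> real) \<Rightarrow> bool" where
  "SME M n k \<beta> Q \<alpha> X \<longleftrightarrow>
     prob_space M \<and>
     1 \<le> n \<and> (\<forall>i\<in>{1..n}. 1 \<le> k i) \<and>
     (\<forall>i\<in>{1..n}. \<forall>j\<in>{1..k i}.
        0 < \<beta> i j \<and> mixing_vector (Q i j) \<and>
        distributed M lborel (X i j) (\<lambda>x. ennreal (me_pdf (\<beta> i j) (Q i j) x))) \<and>
     (\<forall>x. (\<forall>p\<in>sme_index n k. 0 \<le> x p) \<longrightarrow> 0 \<le> sme_bracket n k \<beta> Q \<alpha> x) \<and>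
     distributed M (\<Pi>\<^sub>M p\<in>sme_index n k. lborel)
       (\<lambda>\<omega>. \<lambda>(i, j)\<in>sme_index n k. X i j \<omega>)
       (\<lambda>x. ennreal (sme_pdf n k \<beta> Q \<alpha> x))"

definition sme_T :: "nat \<Rightarrow> nat \<Rightarrow> nat \<Rightarrow> nat" where
  "sme_T s a b = max 1 ((s + 1) * (if a = b then 1 else 0))"

definition sme_xi ::
  "nat \<Rightarrow> (nat \<Rightarrow> nat) \<Rightarrow> (nat \<Rightarrow> nat \<Rightarrow> real) \<Rightarrow> (nat \<Rightarrow> nat \<Rightarrow> nat \<Rightarrow> real) \<Rightarrow>
   (nat \<Rightarrow> nat \<Rightarrow> nat \<Rightarrow> nat \<Rightarrow> real) \<Rightarrow> real" where
  "sme_xi n k \<beta> Q \<alpha> =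
     1 + (\<Sum>a=1..n. \<Sum>b=a..n. \<Sum>s=1..k a. \<Sum>t=sme_T s a b..k b.
            \<alpha> a b s t * me_gamma (\<beta> a s) (Q a s) * me_gamma (\<beta> b t) (Q b t))"


section \<open>Mixing vectors of the auxiliary variables\<close>

text \<open>
  The auxiliary variables enter through their distributions \<open>ME(2 \<beta> n (k n), \<dots>)\<close>:
  \<open>mix_S1 \<dots> j\<close>, \<open>mix_S2 \<dots> a s j\<close>, \<open>mix_S3 \<dots> a b s t j\<close> are the mixing vectors of
  \<open>S\<^sub>j\<close> with superscripts \<open>(1)\<close>, \<open>(2;a)\<close>, \<open>(3;a,b)\<close>. Since \<open>V\<close> doubles the associated
  scale, the source scale of \<open>\<Psi>\<close> is doubled exactly where \<open>M\<close> applies \<open>V\<close>.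
\<close>

definition mix_M ::
  "(nat \<Rightarrow> nat \<Rightarrow> nat \<Rightarrow> real) \<Rightarrow> nat \<Rightarrow> nat \<Rightarrow> nat \<Rightarrow> nat \<Rightarrow> nat \<Rightarrow> nat \<Rightarrow> nat \<Rightarrow> real" where
  "mix_M Q a b s t j l = (if (j, l) \<in> {(a, s), (b, t)} then mix_V (Q j l) else Q j l)"

definition scale_M ::
  "(nat \<Rightarrow> nat \<Rightarrow> real) \<Rightarrow> nat \<Rightarrow> nat \<Rightarrow> nat \<Rightarrow> nat \<Rightarrow> nat \<Rightarrow> nat \<Rightarrow> real" where
  "scale_M \<beta> a b s t j l = (if (j, l) \<in> {(a, s), (b, t)} then 2 * \<beta> j l else \<beta> j l)"

definition mix_S1 ::
  "nat \<Rightarrow> (nat \<Rightarrow> nat) \<Rightarrow> (nat \<Rightarrow> nat \<Rightarrow> real) \<Rightarrow> (nat \<Rightarrow> nat \<Rightarrow> nat \<Rightarrow> real) \<Rightarrow>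
   nat \<Rightarrow> nat \<Rightarrow> real" where
  "mix_S1 n k \<beta> Q j = mix_Pi (\<lambda>l. mix_Psi (\<beta> j l) (2 * \<beta> n (k n)) (Q j l)) (k j)"

definition mix_S3 ::
  "nat \<Rightarrow> (nat \<Rightarrow> nat) \<Rightarrow> (nat \<Rightarrow> nat \<Rightarrow> real) \<Rightarrow> (nat \<Rightarrow> nat \<Rightarrow> nat \<Rightarrow> real) \<Rightarrow>
   nat \<Rightarrow> nat \<Rightarrow> nat \<Rightarrow> nat \<Rightarrow> nat \<Rightarrow> nat \<Rightarrow> real" where
  "mix_S3 n k \<beta> Q a b s t j =
     mix_Pi (\<lambda>l. mix_Psi (scale_M \<beta> a b s t j l) (2 * \<beta> n (k n)) (mix_M Q a b s t j l)) (k j)"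

definition mix_S2 ::
  "nat \<Rightarrow> (nat \<Rightarrow> nat) \<Rightarrow> (nat \<Rightarrow> nat \<Rightarrow> real) \<Rightarrow> (nat \<Rightarrow> nat \<Rightarrow> nat \<Rightarrow> real) \<Rightarrow>
   nat \<Rightarrow> nat \<Rightarrow> nat \<Rightarrow> nat \<Rightarrow> real" where
  "mix_S2 n k \<beta> Q a s j = mix_S3 n k \<beta> Q a a s s j"

text \<open>The lists \<open>[j\<^sub>1, \<dots>, j\<^sub>m]\<close> with \<open>1 \<le> j\<^sub>1 < \<dots> < j\<^sub>m \<le> n\<close>.\<close>

definition increasing_lists :: "nat \<Rightarrow> nat \<Rightarrow> nat list set" where
  "increasing_lists n m = {js. length js = m \<and> sorted_wrt (<) js \<and> set js \<subseteq> {1..n}}"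

end

theory Submission
  imports Defs
begin

text \<open>
  Multiplying out the Sarmanov bracket turns the joint density into a signed sum of product
  densities. Writing \<open>f\<close> for the marginal densities, each factor \<open>\<phi> = f - \<gamma>\<close> contributes either
  \<open>-\<gamma>\<close> or an extra \<open>f\<close>, and \<open>f\<^sup>2 = \<gamma> v\<close> where \<open>v\<close> is again a mixed Erlang density, with doubled
  scale and mixing vector \<open>V(Q)\<close> (\<open>me_pdf_square\<close>). Each term is therefore a constant times a product
  of mixed Erlang densities in which none, one or two marginals \<open>f\<close> have been replaced by \<open>v\<close>
  (\<open>sme_pdf_expansion\<close>). Integrating, the probability of any event is the same signed sum of
  its probabilities under laws with independent coordinates (\<open>SME_probability\<close>).

  Under each of these laws everything is explicit. All scales can be raised to the common value
  \<open>B = 2 \<beta> n (k n)\<close>: an Erlang density is a negative binomial mixture of Erlang densities of a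
  larger scale (\<open>ME_mix_Psi\<close>). At a common scale, Erlang densities are closed under convolution with
  shapes adding up, so mixing vectors convolve (\<open>convolution_ME\<close>); hence the block sums are independent
  and mixed Erlang with the mixing vectors of the auxiliary variables (\<open>distr_block_sums\<close>). By the
  binomial theorem the density of a mixed Erlang variable at \<open>d + u\<close> is a mixture of Erlang densities in
  \<open>u\<close> with weights \<open>\<Delta>\<close> (\<open>me_dens_add\<close>), so that the excesses over the thresholds also add up
  within the Erlang family, which produces \<open>H\<close> (\<open>exceedance_event_probability\<close>).

  Finally the event that the total excess is at most \<open>y\<close> is split according to which block sums
  exceed their thresholds (\<open>stop_loss_decomposition\<close>). If none does, the total excess is \<open>0 \<le> y\<close>,
  which gives the first term; each nonempty set of exceeding blocks gives one event of the kind computed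
  above.

  Densities and probabilities are computed in \<^typ>\<open>ennreal\<close>, where series and integrals may be exchanged
  freely, and are read back as real numbers only at the end.
\<close>

section \<open>Rearrangement of double series\<close>

lemma suminf_ennreal_swap:
  fixes g :: "nat \<Rightarrow> nat \<Rightarrow> ennreal"
  shows "(\<Sum>i. \<Sum>j. g i j) = (\<Sum>j. \<Sum>i. g i j)"
proof -
  have "(\<Sum>i. \<Sum>j. g i j) = (\<integral>\<^sup>+i. (\<Sum>j. g i j) \<partial>count_space UNIV)"
    by (simp add: nn_integral_count_space_nat)
  also have "\<dots> = (\<Sum>j. \<integral>\<^sup>+i. g i j \<partial>count_space UNIV)"
    by (rule nn_integral_suminf) simp
  finally show ?thesis
    by (simp add: nn_integral_count_space_nat)
qed

text \<open>
  Products of two mixtures are double series over the two component indices; this regroups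
  them by the index of the resulting Erlang component.
\<close>

lemma suminf_ennreal_triangle:
  fixes f :: "nat \<Rightarrow> nat \<Rightarrow> ennreal"
  shows "(\<Sum>i. \<Sum>j. f i j) = (\<Sum>k. \<Sum>i\<le>k. f i (k - i))"
proof -
  have "(\<Sum>j. f i j) = (\<Sum>k. if i \<le> k then f i (k - i) else 0)" for i
    by (subst suminf_offset[of _ i]) (auto simp: summableI)
  hence "(\<Sum>i. \<Sum>j. f i j) = (\<Sum>i. \<Sum>k. if i \<le> k then f i (k - i) else 0)"
    by simp
  also have "\<dots> = (\<Sum>k. \<Sum>i. if i \<le> k then f i (k - i) else 0)"
    by (rule suminf_ennreal_swap)
  also have "(\<lambda>k. \<Sum>i. if i \<le> k then f i (k - i) else 0) = (\<lambda>k. \<Sum>i\<le>k. f i (k - i))"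
  proof
    fix k
    have "(\<Sum>i. if i \<le> k then f i (k - i) else 0) = (\<Sum>i\<le>k. if i \<le> k then f i (k - i) else 0)"
      by (rule suminf_finite) auto
    also have "\<dots> = (\<Sum>i\<le>k. f i (k - i))"
      by (rule sum.cong) auto
    finally show "(\<Sum>i. if i \<le> k then f i (k - i) else 0) = (\<Sum>i\<le>k. f i (k - i))" .
  qed
  finally show ?thesis .
qed

section \<open>Mixed Erlang densities\<close>

text \<open>
  The density of \<open>ME(\<beta>, q)\<close> as an extended nonnegative series: unlike \<^const>\<open>me_pdf\<close>, it can be
  manipulated without summability side conditions.
\<close>

definition me_dens :: "real \<Rightarrow> (nat \<Rightarrow> real) \<Rightarrow> real \<Rightarrow> ennreal" where
  "me_dens \<beta> q x = (\<Sum>k. ennreal (q (Suc k)) * ennreal (erlang_density k \<beta> x))"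

lemma borel_measurable_me_dens [measurable]: "me_dens \<beta> q \<in> borel_measurable borel"
  unfolding me_dens_def[abs_def] by measurable

text \<open>
  An Erlang density is \<open>\<beta>\<close> times a Poisson probability. The bound is uniform in the shape, so it
  makes every mixture of Erlang densities summable.
\<close>

lemma erlang_density_le:
  assumes "0 < \<beta>"
  shows "erlang_density k \<beta> x \<le> \<beta>"
proof (cases "x \<le> 0")
  case True
  thus ?thesis using assms by (cases k) (auto simp: erlang_density_def)
next
  case False
  hence "erlang_density k \<beta> x = \<beta> * pmf (poisson_pmf (\<beta> * x)) k"
    using assms by (simp add: pmf_poisson erlang_density_def field_simps)
  also have "\<dots> \<le> \<beta> * 1"
    using assms by (intro mult_left_mono pmf_le_1) auto
  finally show ?thesis by simp
qed

lemma mixing_vectorD: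
  assumes "mixing_vector q"
  shows "0 \<le> q (Suc k)" "summable (\<lambda>k. q (Suc k))" "(\<lambda>k. q (Suc k)) sums 1"
  using assms by (auto simp: mixing_vector_def sums_iff)

lemma summable_mixture:
  assumes "mixing_vector q" "\<And>k. 0 \<le> c k" "\<And>k. c k \<le> C"
  shows "summable (\<lambda>k. q (Suc k) * c k)"
proof (rule summable_comparison_test')
  show "summable (\<lambda>k. q (Suc k) * C)"
    by (intro summable_mult2 mixing_vectorD assms)
  show "norm (q (Suc k) * c k) \<le> q (Suc k) * C" for k
    using assms mixing_vectorD[OF assms(1)] by (auto simp: abs_mult intro!: mult_mono)
qed

lemma ennreal_me_pdf:
  assumes "0 < \<beta>" "mixing_vector q"
  shows "ennreal (me_pdf \<beta> q x) = me_dens \<beta> q x"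
  unfolding me_dens_def me_pdf_def using assms mixing_vectorD[OF assms(2)]
  by (subst suminf_ennreal2[symmetric])
     (auto intro!: summable_mixture[where C=\<beta>] erlang_density_le simp: ennreal_mult)

lemma me_pdf_nonneg:
  assumes "0 < \<beta>" "mixing_vector q"
  shows "0 \<le> me_pdf \<beta> q x"
  unfolding me_pdf_def using assms mixing_vectorD[OF assms(2)]
  by (intro suminf_nonneg summable_mixture[where C=\<beta>]) (auto intro: erlang_density_le)

lemma me_pdf_neg: "x < 0 \<Longrightarrow> me_pdf \<beta> q x = 0"
  by (simp add: me_pdf_def erlang_density_def)

lemma borel_measurable_me_pdf [measurable]: "me_pdf \<beta> q \<in> borel_measurable borel"
  unfolding me_pdf_def[abs_def] by measurable

lemma ME_eq_density_me_dens:
  assumes "0 < \<beta>" "mixing_vector q"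
  shows "ME \<beta> q = density lborel (me_dens \<beta> q)"
  unfolding ME_def using ennreal_me_pdf[OF assms] by simp

lemma nn_integral_erlang:
  assumes "0 < \<beta>"
  shows "(\<integral>\<^sup>+x. ennreal (erlang_density k \<beta> x) \<partial>lborel) = 1"
  using nn_integral_erlang_ith_moment[OF assms, of k 0] by simp

lemma nn_integral_me_dens:
  assumes "0 < \<beta>"
  shows "(\<integral>\<^sup>+x. me_dens \<beta> q x \<partial>lborel) = (\<Sum>k. ennreal (q (Suc k)))"
  using assms unfolding me_dens_def
  by (simp add: nn_integral_suminf nn_integral_cmult nn_integral_erlang)

text \<open>
  Every Erlang density has mass \<open>1\<close>, so the weights sum to the total mass of the mixture. This
  reduces normalisation of a transformed mixing vector to the fact that the mixture is a probability
  density.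
\<close>

lemma mixing_vector_iff_nn_integral:
  assumes "0 < \<beta>" "\<And>k. 0 \<le> q (Suc k)"
  shows "mixing_vector q \<longleftrightarrow> (\<integral>\<^sup>+x. me_dens \<beta> q x \<partial>lborel) = 1"
proof -
  have "mixing_vector q \<longleftrightarrow> (\<lambda>k. q (Suc k)) sums 1"
    using assms(2) by (auto simp: mixing_vector_def) (metis Suc_diff_le diff_Suc_1 One_nat_def)
  also have "\<dots> \<longleftrightarrow> (\<lambda>k. ennreal (q (Suc k))) sums ennreal 1"
    using assms(2) by (subst sums_ennreal) auto
  also have "\<dots> \<longleftrightarrow> (\<Sum>k. ennreal (q (Suc k))) = 1"
    by (simp add: sums_iff summableI)
  finally show ?thesis using assms by (simp add: nn_integral_me_dens)
qed

lemma prob_space_ME: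
  assumes "0 < \<beta>" "mixing_vector q"
  shows "prob_space (ME \<beta> q)"
  unfolding ME_eq_density_me_dens[OF assms]
  using mixing_vector_iff_nn_integral[of \<beta> q] mixing_vectorD[OF assms(2)] assms
  by (intro prob_spaceI) (simp add: emeasure_density)

lemma sets_ME [simp, measurable_cong]: "sets (ME \<beta> q) = sets borel"
  by (simp add: ME_def)

lemma space_ME [simp]: "space (ME \<beta> q) = UNIV"
  by (simp add: ME_def)

section \<open>Change of scale\<close>

lemma mix_Psi_nonneg:
  assumes "0 < \<beta>1" "\<beta>1 \<le> \<beta>2" "mixing_vector q"
  shows "0 \<le> mix_Psi \<beta>1 \<beta>2 q k"
proof -
  have "0 \<le> q i" if "i \<in> {1..k}" for i
    using assms(3) that by (auto simp: mixing_vector_def)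
  thus ?thesis
    using assms unfolding mix_Psi_def
    by (intro sum_nonneg mult_nonneg_nonneg zero_le_power) (auto simp: field_simps)
qed

text \<open>
  With \<open>p = \<beta>1 / \<beta>2\<close>, this is the exponential series of \<open>exp ((1 - p) \<beta>2 x)\<close>, which is what
  separates \<open>exp (- \<beta>1 x)\<close> from \<open>exp (- \<beta>2 x)\<close>. Probabilistically, a sum of \<open>i + 1\<close> exponential
  variables of rate \<open>\<beta>1\<close> is a sum of a negative binomial number of exponential variables of rate \<open>\<beta>2\<close>.
\<close>

lemma erlang_density_rescale:
  assumes "0 < \<beta>1" "\<beta>1 \<le> \<beta>2"
  defines "p \<equiv> \<beta>1 / \<beta>2"
  shows "ennreal (erlang_density i \<beta>1 x) =
    (\<Sum>m. ennreal (real ((i + m) choose m) * p ^ Suc i * (1 - p) ^ m) * ennreal (erlang_density (i + m) \<beta>2 x))"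
proof (cases "x < 0")
  case False
  have p: "0 < p" "p \<le> 1" using assms by (auto simp: p_def)
  let ?C = "\<beta>1 ^ Suc i * x ^ i * exp (- \<beta>2 * x) / fact i"
  have 1: "real ((i + m) choose m) * p ^ Suc i * (1 - p) ^ m * erlang_density (i + m) \<beta>2 x =
     ?C * (((\<beta>2 - \<beta>1) * x) ^ m /\<^sub>R fact m)" for m
  proof -
    have "(1 - p) * \<beta>2 = \<beta>2 - \<beta>1" "p * \<beta>2 = \<beta>1"
      using assms by (auto simp: p_def field_simps)
    hence e: "((\<beta>2 - \<beta>1) * x)^m = (1 - p)^m * \<beta>2^m * x^m" "\<beta>1 ^ Suc i = p ^ Suc i * \<beta>2 ^ Suc i"
      by (metis power_mult_distrib)+
    have "real ((i + m) choose m) = fact (i + m) / (fact i * fact m)"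
      by (subst binomial_fact) (auto simp: mult.commute)
    thus ?thesis using False unfolding e
      by (simp add: erlang_density_def power_add divide_simps)
  qed
  have "(\<lambda>m. ?C * (((\<beta>2 - \<beta>1) * x) ^ m /\<^sub>R fact m)) sums (?C * exp ((\<beta>2 - \<beta>1) * x))"
    by (intro sums_mult exp_converges)
  also have "?C * exp ((\<beta>2 - \<beta>1) * x) = erlang_density i \<beta>1 x"
    using False by (simp add: erlang_density_def exp_add[symmetric] algebra_simps)
  finally have "(\<lambda>m. ?C * (((\<beta>2 - \<beta>1) * x) ^ m /\<^sub>R fact m)) sums erlang_density i \<beta>1 x" .
  from sums_cong[THEN iffD2, OF 1 this]
  have s: "(\<lambda>m. real ((i + m) choose m) * p ^ Suc i * (1 - p) ^ m * erlang_density (i + m) \<beta>2 x)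
     sums erlang_density i \<beta>1 x" .
  have "(\<Sum>m. ennreal (real ((i + m) choose m) * p ^ Suc i * (1 - p) ^ m * erlang_density (i + m) \<beta>2 x)) =
    ennreal (erlang_density i \<beta>1 x)"
    using p assms(1,2) by (intro suminf_ennreal_eq[OF _ s]) auto
  moreover have "ennreal (real ((i + m) choose m) * p ^ Suc i * (1 - p) ^ m * erlang_density (i + m) \<beta>2 x) =
    ennreal (real ((i + m) choose m) * p ^ Suc i * (1 - p) ^ m) * ennreal (erlang_density (i + m) \<beta>2 x)" for m
    using p assms(1,2) by (intro ennreal_mult) auto
  ultimately show ?thesis by (metis (no_types, lifting) suminf_cong)
qed (simp add: erlang_density_def)

lemma me_dens_mix_Psi:
  assumes "0 < \<beta>1" "\<beta>1 \<le> \<beta>2" "mixing_vector q"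
  shows "me_dens \<beta>2 (mix_Psi \<beta>1 \<beta>2 q) = me_dens \<beta>1 q"
proof
  fix x
  define p where "p = \<beta>1 / \<beta>2"
  have p: "0 < p" "p \<le> 1" using assms by (auto simp: p_def)
  note q = mixing_vectorD[OF assms(3)]
  define c where "c = (\<lambda>i m. q (Suc i) * (real ((i + m) choose m) * p ^ Suc i * (1 - p) ^ m))"
  have c: "0 \<le> c i m" for i m using p q by (auto simp: c_def)
  have "me_dens \<beta>1 q x = (\<Sum>i. \<Sum>m. ennreal (c i m) * ennreal (erlang_density (i + m) \<beta>2 x))"
    unfolding me_dens_def erlang_density_rescale[OF assms(1,2)] ennreal_suminf_cmult[symmetric]
      p_def[symmetric] c_def
    using p q by (simp add: ennreal_mult mult.assoc)
  also have "\<dots> = (\<Sum>k. \<Sum>i\<le>k. ennreal (c i (k - i)) * ennreal (erlang_density (i + (k - i)) \<beta>2 x))"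
    by (rule suminf_ennreal_triangle)
  also have "\<dots> = (\<Sum>k. ennreal (\<Sum>i\<le>k. c i (k - i)) * ennreal (erlang_density k \<beta>2 x))"
    using c by (simp add: sum_distrib_right sum_ennreal[symmetric] del: sum_ennreal)
  also have "(\<lambda>k. \<Sum>i\<le>k. c i (k - i)) = (\<lambda>k. mix_Psi \<beta>1 \<beta>2 q (Suc k))"
    unfolding mix_Psi_def c_def p_def[symmetric]
    by (intro ext, rule sum.reindex_bij_witness[of _ "\<lambda>i. i - 1" Suc])
       (auto simp: mult_ac Suc_diff_le)
  finally show "me_dens \<beta>2 (mix_Psi \<beta>1 \<beta>2 q) x = me_dens \<beta>1 q x"
    unfolding me_dens_def by simp
qed

lemma mixing_vector_mix_Psi:
  assumes "0 < \<beta>1" "\<beta>1 \<le> \<beta>2" "mixing_vector q"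
  shows "mixing_vector (mix_Psi \<beta>1 \<beta>2 q)"
  using assms mixing_vector_iff_nn_integral[of \<beta>1 q] mixing_vectorD[OF assms(3)]
  by (subst mixing_vector_iff_nn_integral[of \<beta>2]) (auto simp: me_dens_mix_Psi mix_Psi_nonneg)

lemma ME_mix_Psi:
  assumes "0 < \<beta>1" "\<beta>1 \<le> \<beta>2" "mixing_vector q"
  shows "ME \<beta>2 (mix_Psi \<beta>1 \<beta>2 q) = ME \<beta>1 q"
  using assms by (simp add: ME_eq_density_me_dens mixing_vector_mix_Psi me_dens_mix_Psi)

section \<open>Squares of mixed Erlang densities\<close>

lemma erlang_density_mult:
  "erlang_density i \<beta> x * erlang_density j \<beta> x =
   \<beta> * (real ((i + j) choose i) / 2 ^ Suc (i + j)) * erlang_density (i + j) (2 * \<beta>) x"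
proof -
  have "exp (- (\<beta> * x)) * exp (- (\<beta> * x)) = exp (- (2 * \<beta> * x))"
    by (simp add: exp_add[symmetric])
  moreover have "real ((i + j) choose i) = fact (i + j) / (fact i * fact j)"
    by (subst binomial_fact) auto
  ultimately show ?thesis
    by (simp add: erlang_density_def power_add power_mult_distrib divide_simps mult_ac)
qed

text \<open>
  \<^term>\<open>V_num q k\<close> and \<^term>\<open>V_den q\<close> are the numerator and the denominator of \<^term>\<open>mix_V q k\<close>. The numerators
  are the weights of \<open>f\<^sup>2 / \<beta>\<close> as a mixture at scale \<open>2 \<beta>\<close>, and the denominator is their sum.
\<close>

definition V_num :: "(nat \<Rightarrow> real) \<Rightarrow> nat \<Rightarrow> real" where
  "V_num q k = (\<Sum>i=1..k. real ((k - 1) choose (i - 1)) * q i * q (k + 1 - i)) / 2 ^ k"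

definition V_den :: "(nat \<Rightarrow> real) \<Rightarrow> real" where
  "V_den q = (\<Sum>i. \<Sum>j. real ((i + j) choose i) * q (Suc i) * q (Suc j) / 2 ^ (i + j + 1))"

lemma mix_V_eq: "mix_V q k = V_num q k / V_den q"
  by (simp add: mix_V_def V_num_def V_den_def)

lemma V_num_nonneg:
  assumes "mixing_vector q"
  shows "0 \<le> V_num q k"
proof -
  have "0 \<le> q i" if "i \<in> {1..k}" for i
    using assms that by (auto simp: mixing_vector_def)
  moreover have "0 \<le> q (k + 1 - i)" if "i \<in> {1..k}" for i
    using assms that by (auto simp: mixing_vector_def)
  ultimately show ?thesis unfolding V_num_def by (auto intro!: sum_nonneg divide_nonneg_pos)
qed

lemma V_num_Suc:
  "V_num q (Suc k) = (\<Sum>i\<le>k. real ((i + (k - i)) choose i) * q (Suc i) * q (Suc (k - i)) / 2 ^ Suc (i + (k - i)))"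
  unfolding V_num_def sum_divide_distrib
  by (rule sum.reindex_bij_witness[of _ Suc "\<lambda>i. i - 1"]) (auto simp: Suc_diff_le)

lemma me_dens_square_V_num:
  assumes "0 < \<beta>" "mixing_vector q"
  shows "me_dens \<beta> q x * me_dens \<beta> q x = ennreal \<beta> * me_dens (2 * \<beta>) (V_num q) x"
proof -
  note q = mixing_vectorD[OF assms(2)]
  let ?e = "\<lambda>k. erlang_density k \<beta> x" and ?e2 = "\<lambda>k. ennreal (erlang_density k (2 * \<beta>) x)"
  define c where "c = (\<lambda>i j. real ((i + j) choose i) * q (Suc i) * q (Suc j) / 2 ^ Suc (i + j))"
  have c: "0 \<le> c i j" for i j using q by (simp add: c_def)
  have "me_dens \<beta> q x * me_dens \<beta> q x =
     (\<Sum>i. \<Sum>j. ennreal (q (Suc i)) * ennreal (?e i) * (ennreal (q (Suc j)) * ennreal (?e j)))"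
    by (simp add: me_dens_def)
  also have "\<dots> = (\<Sum>i. \<Sum>j. ennreal \<beta> * (ennreal (c i j) * ?e2 (i + j)))"
  proof (intro suminf_cong)
    fix i j
    have "ennreal (q (Suc i)) * ennreal (?e i) * (ennreal (q (Suc j)) * ennreal (?e j)) =
        ennreal (q (Suc i) * q (Suc j) * (?e i * ?e j))"
      using q assms by (simp add: ennreal_mult mult_ac)
    also have "q (Suc i) * q (Suc j) * (?e i * ?e j) = \<beta> * (c i j * erlang_density (i + j) (2 * \<beta>) x)"
      unfolding erlang_density_mult by (simp add: c_def field_simps)
    finally show "ennreal (q (Suc i)) * ennreal (?e i) * (ennreal (q (Suc j)) * ennreal (?e j))
        = ennreal \<beta> * (ennreal (c i j) * ?e2 (i + j))"
      using c assms by (simp add: ennreal_mult)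
  qed
  also have "\<dots> = ennreal \<beta> * (\<Sum>i. \<Sum>j. ennreal (c i j) * ?e2 (i + j))"
    by simp
  also have "(\<Sum>i. \<Sum>j. ennreal (c i j) * ?e2 (i + j)) = (\<Sum>k. \<Sum>i\<le>k. ennreal (c i (k - i)) * ?e2 (i + (k - i)))"
    by (rule suminf_ennreal_triangle)
  also have "\<dots> = (\<Sum>k. ennreal (\<Sum>i\<le>k. c i (k - i)) * ?e2 k)"
    using c by (simp add: sum_distrib_right sum_ennreal[symmetric] del: sum_ennreal)
  also have "(\<lambda>k. \<Sum>i\<le>k. c i (k - i)) = (\<lambda>k. V_num q (Suc k))"
    unfolding V_num_Suc c_def by simp
  finally show ?thesis by (simp add: me_dens_def)
qed

text \<open>
  The real iterated series in the denominator agrees with the freely rearranged extended one because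
  the coefficients are dominated by \<open>q\<^sub>i q\<^sub>j\<close>. Some weight of \<open>q\<close> is nonzero, and its diagonal term
  makes the sum positive.
\<close>

lemma suminf_V_num:
  assumes "mixing_vector q"
  shows "(\<Sum>k. ennreal (V_num q (Suc k))) = ennreal (V_den q)" "0 < V_den q"
proof -
  note q = mixing_vectorD[OF assms]
  define c where "c = (\<lambda>i j. real ((i + j) choose i) * q (Suc i) * q (Suc j) / 2 ^ (i + j + 1))"
  have c: "0 \<le> c i j" for i j using q by (simp add: c_def)
  have cle: "c i j \<le> q (Suc i) * q (Suc j)" for i j
  proof -
    have "real ((i + j) choose i) \<le> 2 ^ (i + j)"
      using binomial_le_pow2[of "i + j" i] by (metis of_nat_le_iff of_nat_numeral of_nat_power)
    also have "\<dots> \<le> 2 ^ (i + j + 1)" by simp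
    finally have "real ((i + j) choose i) / 2 ^ (i + j + 1) * (q (Suc i) * q (Suc j)) \<le> 1 * (q (Suc i) * q (Suc j))"
      using q by (intro mult_right_mono) (auto simp: divide_simps)
    thus ?thesis by (simp add: c_def mult_ac)
  qed
  have s1: "summable (c i)" for i
    by (rule summable_comparison_test'[where g="\<lambda>j. q (Suc i) * q (Suc j)"])
       (use c cle in \<open>auto intro!: summable_mult q\<close>)
  have i1: "(\<Sum>j. ennreal (c i j)) = ennreal (suminf (c i))" for i
    using c s1 by (simp add: suminf_ennreal2)
  have n1: "0 \<le> suminf (c i)" for i using c s1 by (simp add: suminf_nonneg)
  have "suminf (c i) \<le> (\<Sum>j. q (Suc i) * q (Suc j))" for i
    by (intro suminf_le cle s1 summable_mult q)
  also have "(\<Sum>j. q (Suc i) * q (Suc j)) = q (Suc i)" for i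
    using q(3) by (simp add: suminf_mult q(2) sums_iff)
  finally have s2: "summable (\<lambda>i. suminf (c i))"
    using n1 by (intro summable_comparison_test'[OF q(2)]) auto
  have D: "V_den q = (\<Sum>i. suminf (c i))" by (simp add: V_den_def c_def)
  have "(\<Sum>k. ennreal (V_num q (Suc k))) = (\<Sum>k. \<Sum>i\<le>k. ennreal (c i (k - i)))"
  proof (intro suminf_cong)
    fix k
    have "(\<Sum>i\<le>k. ennreal (c i (k - i))) = ennreal (\<Sum>i\<le>k. c i (k - i))"
      by (rule sum_ennreal) (rule c)
    thus "ennreal (V_num q (Suc k)) = (\<Sum>i\<le>k. ennreal (c i (k - i)))"
      by (simp add: V_num_Suc c_def)
  qed
  also have "\<dots> = (\<Sum>i. \<Sum>j. ennreal (c i j))"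
    by (rule suminf_ennreal_triangle[symmetric])
  also have "\<dots> = ennreal (V_den q)"
    unfolding i1 D using n1 s2 by (simp add: suminf_ennreal2)
  finally show "(\<Sum>k. ennreal (V_num q (Suc k))) = ennreal (V_den q)" .
  have "\<exists>i. q (Suc i) \<noteq> 0"
  proof (rule ccontr)
    assume "\<not> ?thesis"
    hence "(\<lambda>i. q (Suc i)) sums 0" by simp
    with q(3) show False using sums_unique2 by fastforce
  qed
  then obtain i where i: "q (Suc i) \<noteq> 0" by blast
  hence "0 < c i i" using q(1)[of i] by (simp add: c_def)
  also have "c i i \<le> suminf (c i)"
    using sum_le_suminf[OF s1, of "{i}" i] c by simp
  finally have "0 < suminf (c i)" .
  thus "0 < V_den q" unfolding D using n1 s2 suminf_pos2 by blast
qed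

lemma me_dens_cdiv:
  assumes "0 < D" "\<And>k. 0 \<le> q (Suc k)"
  shows "me_dens \<beta> q x = ennreal D * me_dens \<beta> (\<lambda>k. q k / D) x"
proof -
  have "ennreal (q (Suc k)) = ennreal D * ennreal (q (Suc k) / D)" for k
    using assms by (simp add: ennreal_mult[symmetric])
  thus ?thesis unfolding me_dens_def
    by (simp add: mult.assoc)
qed

lemma mixing_vector_mix_V:
  assumes "mixing_vector q"
  shows "mixing_vector (mix_V q)"
proof -
  note D = suminf_V_num[OF assms]
  have "(\<lambda>k. ennreal (V_num q (Suc k))) sums ennreal (V_den q)"
    using D by (simp add: sums_iff summableI)
  hence "(\<lambda>k. V_num q (Suc k)) sums V_den q"
    using V_num_nonneg[OF assms] D by (subst (asm) sums_ennreal) auto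
  hence "(\<lambda>k. V_num q (Suc k) / V_den q) sums (V_den q / V_den q)"
    by (rule sums_divide)
  thus ?thesis using D V_num_nonneg[OF assms] by (simp add: mixing_vector_def mix_V_eq)
qed

lemma me_dens_square:
  assumes "0 < \<beta>" "mixing_vector q"
  shows "me_dens \<beta> q x * me_dens \<beta> q x = ennreal (\<beta> * V_den q) * me_dens (2 * \<beta>) (mix_V q) x"
  unfolding me_dens_square_V_num[OF assms]
  using assms suminf_V_num[OF assms(2)] V_num_nonneg[OF assms(2)]
  by (subst me_dens_cdiv[of "V_den q"]) (auto simp: mix_V_eq[abs_def] ennreal_mult mult.assoc)

text \<open>
  Integrating \<open>f\<^sup>2\<close> as a multiple of a probability density identifies \<open>\<gamma> = E (f X)\<close>.
\<close>

lemma me_gamma_eq: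
  assumes "0 < \<beta>" "mixing_vector q"
  shows "me_gamma \<beta> q = \<beta> * V_den q"
proof -
  have "me_gamma \<beta> q = enn2real (\<integral>\<^sup>+x. ennreal (me_pdf \<beta> q x) \<partial>ME \<beta> q)"
    unfolding me_gamma_def using me_pdf_nonneg[OF assms]
    by (intro integral_eq_nn_integral) (auto simp: measurable_cong_sets[OF sets_ME refl])
  also have "(\<integral>\<^sup>+x. ennreal (me_pdf \<beta> q x) \<partial>ME \<beta> q) = (\<integral>\<^sup>+x. me_dens \<beta> q x * me_dens \<beta> q x \<partial>lborel)"
    unfolding ME_eq_density_me_dens[OF assms] ennreal_me_pdf[OF assms]
    by (subst nn_integral_density) auto
  also have "\<dots> = ennreal (\<beta> * V_den q) * (\<integral>\<^sup>+x. me_dens (2 * \<beta>) (mix_V q) x \<partial>lborel)"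
    unfolding me_dens_square[OF assms] by (rule nn_integral_cmult) simp
  also have "(\<integral>\<^sup>+x. me_dens (2 * \<beta>) (mix_V q) x \<partial>lborel) = 1"
    using mixing_vector_iff_nn_integral[of "2 * \<beta>" "mix_V q"] mixing_vector_mix_V[OF assms(2)] assms
    by (auto dest: mixing_vectorD(1))
  finally show ?thesis using assms suminf_V_num[OF assms(2)] by simp
qed

lemma me_gamma_pos:
  assumes "0 < \<beta>" "mixing_vector q"
  shows "0 < me_gamma \<beta> q"
  using assms me_gamma_eq[OF assms] suminf_V_num(2)[OF assms(2)] by simp

lemma me_pdf_square:
  assumes "0 < \<beta>" "mixing_vector q"
  shows "me_pdf \<beta> q x * me_pdf \<beta> q x = me_gamma \<beta> q * me_pdf (2 * \<beta>) (mix_V q) x"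
proof -
  have b: "0 < 2 * \<beta>" using assms by simp
  note V = mixing_vector_mix_V[OF assms(2)]
  have "ennreal (me_pdf \<beta> q x * me_pdf \<beta> q x) = ennreal (me_gamma \<beta> q * me_pdf (2 * \<beta>) (mix_V q) x)"
    using me_pdf_nonneg[OF assms] me_pdf_nonneg[OF b V] me_gamma_pos[OF assms]
      me_dens_square[OF assms] me_gamma_eq[OF assms]
    by (simp add: ennreal_mult ennreal_me_pdf[OF assms] ennreal_me_pdf[OF b V])
  thus ?thesis
    using me_pdf_nonneg[OF assms] me_pdf_nonneg[OF b V] me_gamma_pos[OF assms]
    by (subst (asm) ennreal_inj) auto
qed

section \<open>Convolutions of mixed Erlang distributions\<close>

definition mix_conv :: "(nat \<Rightarrow> real) \<Rightarrow> (nat \<Rightarrow> real) \<Rightarrow> nat \<Rightarrow> real" where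
  "mix_conv p q l = (\<Sum>j=1..l - 1. p j * q (l - j))"

lemma mix_conv_Suc_0: "mix_conv p q (Suc 0) = 0"
  by (simp add: mix_conv_def)

lemma mix_conv_Suc_Suc: "mix_conv p q (Suc (Suc k)) = (\<Sum>i\<le>k. p (Suc i) * q (Suc (k - i)))"
  unfolding mix_conv_def
  by (rule sum.reindex_bij_witness[of _ Suc "\<lambda>i. i - 1"]) (auto simp: Suc_diff_le)

text \<open>
  Erlang densities of equal scale convolve by adding shapes, hence the weights convolve as sequences.
\<close>

lemma convolution_me_dens:
  assumes "0 < \<beta>" "mixing_vector p" "mixing_vector q"
  shows "(\<integral>\<^sup>+y. me_dens \<beta> p (x - y) * me_dens \<beta> q y \<partial>lborel) = me_dens \<beta> (mix_conv p q) x"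
proof -
  note p = mixing_vectorD(1)[OF assms(2)] and q = mixing_vectorD(1)[OF assms(3)]
  let ?e = "\<lambda>k x. ennreal (erlang_density k \<beta> x)"
  have "(\<integral>\<^sup>+y. me_dens \<beta> p (x - y) * me_dens \<beta> q y \<partial>lborel) =
    (\<integral>\<^sup>+y. (\<Sum>i. \<Sum>j. ennreal (p (Suc i) * q (Suc j)) * (?e i (x - y) * ?e j y)) \<partial>lborel)"
  proof (intro nn_integral_cong)
    fix y
    have "me_dens \<beta> p (x - y) * me_dens \<beta> q y =
      (\<Sum>i. \<Sum>j. (ennreal (p (Suc i)) * ?e i (x - y)) * (ennreal (q (Suc j)) * ?e j y))"
      by (simp add: me_dens_def)
    also have "\<dots> = (\<Sum>i. \<Sum>j. ennreal (p (Suc i) * q (Suc j)) * (?e i (x - y) * ?e j y))"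
      using p q by (intro suminf_cong) (simp add: ennreal_mult mult_ac)
    finally show "me_dens \<beta> p (x - y) * me_dens \<beta> q y =
      (\<Sum>i. \<Sum>j. ennreal (p (Suc i) * q (Suc j)) * (?e i (x - y) * ?e j y))" .
  qed
  also have "\<dots> = (\<Sum>i. \<Sum>j. ennreal (p (Suc i) * q (Suc j)) * (\<integral>\<^sup>+y. ?e i (x - y) * ?e j y \<partial>lborel))"
    by (simp add: nn_integral_suminf nn_integral_cmult)
  also have "\<dots> = (\<Sum>i. \<Sum>j. ennreal (p (Suc i) * q (Suc j)) * ?e (Suc (i + j)) x)"
    using fun_cong[OF convolution_erlang_density[OF assms(1)]] by simp
  also have "\<dots> = (\<Sum>k. \<Sum>i\<le>k. ennreal (p (Suc i) * q (Suc (k - i))) * ?e (Suc (i + (k - i))) x)"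
    by (rule suminf_ennreal_triangle)
  also have "\<dots> = (\<Sum>k. ennreal (mix_conv p q (Suc (Suc k))) * ?e (Suc k) x)"
    unfolding mix_conv_Suc_Suc
    using p q by (simp add: sum_distrib_right sum_ennreal[symmetric] del: sum_ennreal)
  also have "\<dots> = me_dens \<beta> (mix_conv p q) x"
    unfolding me_dens_def by (subst suminf_offset[of _ 1]) (auto simp: summableI mix_conv_Suc_0)
  finally show ?thesis .
qed

lemma convolution_ME:
  assumes "0 < \<beta>" "mixing_vector p" "mixing_vector q"
  shows "ME \<beta> p \<star> ME \<beta> q = ME \<beta> (mix_conv p q)" "mixing_vector (mix_conv p q)"
proof -
  note p = prob_space_ME[OF assms(1,2)] and q = prob_space_ME[OF assms(1,3)]
  interpret P: prob_space "ME \<beta> p" by (rule p)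
  interpret Q: prob_space "ME \<beta> q" by (rule q)
  interpret PQ: pair_prob_space "ME \<beta> p" "ME \<beta> q" ..
  have *: "ME \<beta> p \<star> ME \<beta> q = density lborel (me_dens \<beta> (mix_conv p q))"
    using P.finite_measure_axioms Q.finite_measure_axioms assms
    unfolding ME_eq_density_me_dens[OF assms(1,2)] ME_eq_density_me_dens[OF assms(1,3)]
    by (subst convolution_density) (auto simp: convolution_me_dens)
  have "prob_space (ME \<beta> p \<star> ME \<beta> q)"
    unfolding convolution_def by (rule PQ.prob_space_distr) measurable
  hence "emeasure (density lborel (me_dens \<beta> (mix_conv p q))) UNIV = 1"
    using prob_space.emeasure_space_1 by (fastforce simp: *)
  hence "(\<integral>\<^sup>+x. me_dens \<beta> (mix_conv p q) x \<partial>lborel) = 1"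
    by (simp add: emeasure_density)
  moreover have "0 \<le> mix_conv p q (Suc k)" for k
    using assms(2,3) unfolding mix_conv_def mixing_vector_def
    by (intro sum_nonneg mult_nonneg_nonneg) auto
  ultimately show m: "mixing_vector (mix_conv p q)"
    using mixing_vector_iff_nn_integral[OF assms(1)] by blast
  show "ME \<beta> p \<star> ME \<beta> q = ME \<beta> (mix_conv p q)"
    unfolding * ME_eq_density_me_dens[OF assms(1) m] ..
qed

lemma mix_Pi_low: "0 < m \<Longrightarrow> 0 < l \<Longrightarrow> l < m \<Longrightarrow> mix_Pi qs m l = 0"
  by (cases "(qs, m)" rule: mix_Pi.cases) auto

text \<open>
  The recursion starts its sum at \<open>m\<close> and prescribes zeros below \<open>m + 1\<close>; as the first \<open>m - 1\<close>
  weights of an \<open>m\<close>-fold sum vanish, this is the full convolution.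
\<close>

lemma mix_Pi_Suc: "0 < m \<Longrightarrow> 0 < l \<Longrightarrow> mix_Pi qs (Suc m) l = mix_conv (mix_Pi qs m) (qs (Suc m)) l"
proof -
  assume "0 < m" "0 < l"
  then obtain m' where m: "m = Suc m'" by (cases m) auto
  have "(\<Sum>j=1..l - 1. mix_Pi qs m j * qs (Suc m) (l - j)) = (\<Sum>j=m..l - 1. mix_Pi qs m j * qs (Suc m) (l - j))"
    using mix_Pi_low[OF \<open>0 < m\<close>] \<open>0 < m\<close> by (intro sum.mono_neutral_right) auto
  thus ?thesis using m by (auto simp: mix_conv_def)
qed

lemma ME_cong: "(\<And>l. 0 < l \<Longrightarrow> p l = q l) \<Longrightarrow> ME \<beta> p = ME \<beta> q"
  by (simp add: ME_def me_pdf_def)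

lemma mixing_vector_cong: "(\<And>l. 0 < l \<Longrightarrow> p l = q l) \<Longrightarrow> mixing_vector p \<longleftrightarrow> mixing_vector q"
  by (simp add: mixing_vector_def)

lemma convolution_mix_Pi:
  assumes "0 < \<beta>" "mixing_vector (mix_Pi qs m)" "mixing_vector (qs (Suc m))" "0 < m"
  shows "ME \<beta> (mix_Pi qs m) \<star> ME \<beta> (qs (Suc m)) = ME \<beta> (mix_Pi qs (Suc m))"
    "mixing_vector (mix_Pi qs (Suc m))"
  using convolution_ME[OF assms(1-3)] ME_cong[OF mix_Pi_Suc[OF assms(4)]]
    mixing_vector_cong[OF mix_Pi_Suc[OF assms(4)]] by auto

lemma mixing_vector_mix_Pi:
  assumes "\<And>l. l \<in> {1..m} \<Longrightarrow> mixing_vector (qs l)" "0 < m"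
  shows "mixing_vector (mix_Pi qs m)"
  using assms(2,1)
proof (induction m rule: nat_induct_non_zero)
  case (Suc m)
  thus ?case using convolution_mix_Pi(2)[of 1 qs m] by simp
qed simp

section \<open>Excess over a threshold\<close>

lemma
  assumes "0 < \<beta>" "mixing_vector q"
  shows me_Delta_nonneg: "0 \<le> me_Delta h d \<beta> q"
    and ennreal_me_Delta: "ennreal (me_Delta h d \<beta> q) = (\<Sum>j. ennreal (q (j + h + 1) * erlang_density j \<beta> d / \<beta>))"
proof -
  note q = mixing_vectorD[OF assms(2)]
  have s: "summable (\<lambda>j. q (Suc (j + h)) * erlang_density j \<beta> d)"
  proof (rule summable_comparison_test')
    show "summable (\<lambda>k. q (Suc (k + h)) * \<beta>)"
      using q(2) by (intro summable_mult2) (subst summable_iff_shift[of "\<lambda>k. q (Suc k)"])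
    show "norm (q (Suc (k + h)) * erlang_density k \<beta> d) \<le> q (Suc (k + h)) * \<beta>" for k
      using assms q by (auto simp: abs_mult intro!: mult_mono erlang_density_le)
  qed
  show "0 \<le> me_Delta h d \<beta> q"
    unfolding me_Delta_def using s q assms by (auto intro!: suminf_nonneg divide_nonneg_pos)
  have "me_Delta h d \<beta> q = (\<Sum>j. q (Suc (j + h)) * erlang_density j \<beta> d / \<beta>)"
    unfolding me_Delta_def using suminf_divide[OF s, of \<beta>] by simp
  thus "ennreal (me_Delta h d \<beta> q) = (\<Sum>j. ennreal (q (j + h + 1) * erlang_density j \<beta> d / \<beta>))"
    using s q assms by (auto simp: suminf_ennreal2 summable_divide)
qed

text \<open>
  The binomial expansion of \<open>(d + u)\<^sup>k\<close>.
\<close>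

lemma erlang_density_add:
  assumes "0 < \<beta>" "0 \<le> d" "0 \<le> u"
  shows "erlang_density k \<beta> (d + u) = (\<Sum>h\<le>k. erlang_density (k - h) \<beta> d / \<beta> * erlang_density h \<beta> u)"
proof -
  have "erlang_density (k - h) \<beta> d / \<beta> * erlang_density h \<beta> u =
     \<beta> ^ Suc k * exp (- \<beta> * (d + u)) / fact k * (real (k choose h) * u ^ h * d ^ (k - h))" if "h \<le> k" for h
  proof -
    have e: "exp (- \<beta> * (d + u)) = exp (- \<beta> * d) * exp (- \<beta> * u)"
      by (simp add: exp_add[symmetric] algebra_simps)
    have p: "\<beta> ^ Suc k = \<beta> ^ Suc (k - h) * \<beta> ^ h" using that by (simp add: power_add[symmetric])
    have "real (k choose h) = fact k / (fact h * fact (k - h))"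
      using that by (rule binomial_fact)
    thus ?thesis unfolding e p using assms
      by (simp add: erlang_density_def divide_simps mult_ac)
  qed
  hence "(\<Sum>h\<le>k. erlang_density (k - h) \<beta> d / \<beta> * erlang_density h \<beta> u) =
     \<beta> ^ Suc k * exp (- \<beta> * (d + u)) / fact k * (u + d) ^ k"
    by (simp add: binomial_ring sum_distrib_left)
  thus ?thesis using assms by (simp add: erlang_density_def add.commute mult_ac)
qed

text \<open>
  Beyond the threshold \<open>d\<close> the density is, as a function of the excess \<open>u\<close>, again a mixture of
  Erlang densities of the same scale, with weights \<open>\<Delta>\<close> whose sum is the probability of
  exceeding \<open>d\<close>.
\<close>

lemma me_dens_add:
  assumes "0 < \<beta>" "mixing_vector q" "0 \<le> d" "0 \<le> u"
  shows "me_dens \<beta> q (d + u) = (\<Sum>h. ennreal (me_Delta h d \<beta> q) * ennreal (erlang_density h \<beta> u))"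
proof -
  note q = mixing_vectorD[OF assms(2)]
  define f where "f = (\<lambda>h j. ennreal (q (j + h + 1) * erlang_density j \<beta> d / \<beta>) * ennreal (erlang_density h \<beta> u))"
  have "(\<Sum>h. ennreal (me_Delta h d \<beta> q) * ennreal (erlang_density h \<beta> u)) = (\<Sum>h. \<Sum>j. f h j)"
    unfolding f_def ennreal_suminf_multc ennreal_me_Delta[OF assms(1,2)] ..
  also have "\<dots> = (\<Sum>k. \<Sum>h\<le>k. f h (k - h))"
    by (rule suminf_ennreal_triangle)
  also have "(\<lambda>k. \<Sum>h\<le>k. f h (k - h)) = (\<lambda>k. ennreal (q (Suc k)) * ennreal (erlang_density k \<beta> (d + u)))"
  proof
    fix k
    have "(\<Sum>h\<le>k. f h (k - h)) =
       (\<Sum>h\<le>k. ennreal (q (Suc k) * (erlang_density (k - h) \<beta> d / \<beta> * erlang_density h \<beta> u)))"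
      unfolding f_def using q assms by (intro sum.cong) (auto simp: ennreal_mult[symmetric])
    also have "\<dots> = ennreal (q (Suc k) * erlang_density k \<beta> (d + u))"
      unfolding erlang_density_add[OF assms(1,3,4)] sum_distrib_left
      using q assms by (intro sum_ennreal) auto
    finally show "(\<Sum>h\<le>k. f h (k - h)) = ennreal (q (Suc k)) * ennreal (erlang_density k \<beta> (d + u))"
      using q assms by (simp add: ennreal_mult)
  qed
  finally show ?thesis unfolding me_dens_def ..
qed

section \<open>Iterated series\<close>

text \<open>
  The extended nonnegative counterpart of \<^const>\<open>iterated_suminf\<close>, which commutes with multiplication
  by constants and with integrals.
\<close>

primrec iterated_esuminf :: "nat \<Rightarrow> (nat list \<Rightarrow> ennreal) \<Rightarrow> ennreal" where
  "iterated_esuminf 0 g = g []"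
| "iterated_esuminf (Suc k) g = (\<Sum>h. iterated_esuminf k (\<lambda>hs. g (h # hs)))"

lemma iterated_esuminf_cong:
  "(\<And>hs. length hs = k \<Longrightarrow> g hs = g' hs) \<Longrightarrow> iterated_esuminf k g = iterated_esuminf k g'"
proof (induction k arbitrary: g g')
  case (Suc k)
  have "iterated_esuminf k (\<lambda>hs. g (h # hs)) = iterated_esuminf k (\<lambda>hs. g' (h # hs))" for h
    by (rule Suc.IH) (simp add: Suc.prems)
  thus ?case by simp
qed simp

lemma iterated_esuminf_cmult: "iterated_esuminf k (\<lambda>hs. a * g hs) = a * iterated_esuminf k g"
  by (induction k arbitrary: g) auto

lemma borel_measurable_iterated_esuminf:
  assumes "\<And>hs. g hs \<in> borel_measurable M"
  shows "(\<lambda>x. iterated_esuminf k (\<lambda>hs. g hs x)) \<in> borel_measurable M"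
  using assms by (induction k arbitrary: g) auto

lemma nn_integral_iterated_esuminf:
  assumes "\<And>hs. g hs \<in> borel_measurable M"
  shows "(\<integral>\<^sup>+x. iterated_esuminf k (\<lambda>hs. g hs x) \<partial>M) = iterated_esuminf k (\<lambda>hs. \<integral>\<^sup>+x. g hs x \<partial>M)"
  using assms
proof (induction k arbitrary: g)
  case (Suc k)
  thus ?case using borel_measurable_iterated_esuminf[of "\<lambda>hs. g (_ # hs)" M k]
    by (simp add: nn_integral_suminf)
qed auto

lemma prod_indicator:
  "finite J \<Longrightarrow> (\<Prod>j\<in>J. indicator (S j) (x j) :: ennreal) = indicator {x. \<forall>j\<in>J. x j \<in> S j} x"
  by (induction J rule: finite_induct) (auto simp: indicator_def)

text \<open>
  The terms being nonnegative, finiteness of an iterated series passes to all its inner series, so each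
  level of the real iterated series converges.
\<close>

lemma iterated_esuminf_ennreal:
  assumes "\<And>hs. length hs = k \<Longrightarrow> 0 \<le> g hs"
  assumes "iterated_esuminf k (\<lambda>hs. ennreal (g hs)) \<noteq> \<top>"
  shows "0 \<le> iterated_suminf k g \<and> iterated_esuminf k (\<lambda>hs. ennreal (g hs)) = ennreal (iterated_suminf k g)"
  using assms
proof (induction k arbitrary: g)
  case (Suc k)
  let ?F = "\<lambda>h. iterated_esuminf k (\<lambda>hs. ennreal (g (h # hs)))"
  have "?F h < \<top>" for h
    using Suc.prems(2) by (intro ennreal_suminf_lessD[of ?F]) (simp add: top.not_eq_extremum)
  hence IH: "0 \<le> iterated_suminf k (\<lambda>hs. g (h # hs))"
    "?F h = ennreal (iterated_suminf k (\<lambda>hs. g (h # hs)))" for h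
    using Suc.IH[of "\<lambda>hs. g (h # hs)"] Suc.prems(1) by (auto simp: less_top)
  have nt: "(\<Sum>h. ennreal (iterated_suminf k (\<lambda>hs. g (h # hs)))) \<noteq> \<top>"
    using Suc.prems(2) by (simp add: IH(2))
  have "summable (\<lambda>h. iterated_suminf k (\<lambda>hs. g (h # hs)))"
    using IH(1) nt by (rule summable_suminf_not_top)
  hence "0 \<le> iterated_suminf (Suc k) g"
    using IH(1) by (simp add: suminf_nonneg)
  moreover have "iterated_esuminf (Suc k) (\<lambda>hs. ennreal (g hs)) = ennreal (iterated_suminf (Suc k) g)"
    unfolding iterated_esuminf.simps iterated_suminf.simps IH(2) by (rule suminf_ennreal[OF IH(1) nt])
  ultimately show ?case ..
qed simp

section \<open>Total excess of independent mixed Erlang variables\<close>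

text \<open>
  The distribution function of a sum of \<open>N\<close> independent exponential variables of rate \<open>\<beta>\<close>. The case
  \<open>N = 0\<close> is the point mass at \<open>0\<close>; it lets inductions over lists of variables start at the empty list.
\<close>

definition erlang_sum_CDF :: "nat \<Rightarrow> real \<Rightarrow> real \<Rightarrow> real" where
  "erlang_sum_CDF N \<beta> y = (if N = 0 then indicator {0..} y else erlang_CDF (N - 1) \<beta> y)"

lemma erlang_CDF_nonneg: "0 < \<beta> \<Longrightarrow> 0 \<le> erlang_CDF k \<beta> y"
proof -
  assume b: "0 < \<beta>"
  show ?thesis
  proof (cases "y < 0")
    case False
    hence y: "0 \<le> \<beta> * y" using b by simp
    have "(\<Sum>n\<le>k. (\<beta> * y)^n / fact n) \<le> exp (\<beta> * y)"
    proof -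
      have "(\<Sum>n\<le>k. (\<beta> * y)^n /\<^sub>R fact n) \<le> exp (\<beta> * y)"
        unfolding exp_def using y by (intro sum_le_suminf summable_exp_generic) auto
      thus ?thesis by (simp add: divide_inverse mult.commute)
    qed
    hence "(\<Sum>n\<le>k. (\<beta> * y)^n / fact n) * exp (- (\<beta> * y)) \<le> exp (\<beta> * y) * exp (- (\<beta> * y))"
      by (intro mult_right_mono) auto
    thus ?thesis using False by (simp add: erlang_CDF_def exp_add[symmetric] sum_distrib_right)
  qed (simp add: erlang_CDF_def)
qed

lemma borel_measurable_erlang_sum_CDF [measurable]: "erlang_sum_CDF N \<beta> \<in> borel_measurable borel"
  unfolding erlang_sum_CDF_def[abs_def] erlang_CDF_def[abs_def] by measurable

lemma erlang_sum_CDF_convolution: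
  assumes "0 < \<beta>"
  shows "(\<integral>\<^sup>+u. ennreal (erlang_density h \<beta> u) * ennreal (erlang_sum_CDF N \<beta> (y - u)) \<partial>lborel) =
    ennreal (erlang_sum_CDF (Suc h + N) \<beta> y)"
proof (cases N)
  case 0
  have "(\<integral>\<^sup>+u. ennreal (erlang_density h \<beta> u) * ennreal (erlang_sum_CDF N \<beta> (y - u)) \<partial>lborel) =
    (\<integral>\<^sup>+u. ennreal (erlang_density h \<beta> u) * indicator {..y} u \<partial>lborel)"
    using 0 by (intro nn_integral_cong) (auto simp: erlang_sum_CDF_def indicator_def)
  thus ?thesis using 0 assms by (simp add: nn_integral_erlang_density erlang_sum_CDF_def)
next
  case (Suc k)
  let ?E = "\<lambda>k. density lborel (\<lambda>x. ennreal (erlang_density k \<beta> x))"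
  have fin: "finite_measure (?E k)" for k
    using prob_space_erlang_density[OF assms] by (rule prob_space.finite_measure)
  have "ennreal (erlang_sum_CDF (Suc h + N) \<beta> y) = emeasure (?E (Suc (h + k))) {..y}"
    using Suc emeasure_erlang_density[OF assms, of "Suc (h + k)" y] by (simp add: erlang_sum_CDF_def)
  also have "?E (Suc (h + k)) = (?E h \<star> ?E k)"
    using convolution_erlang_density[OF assms, of h k] fin by (subst convolution_density) auto
  also have "emeasure (?E h \<star> ?E k) {..y} = (\<integral>\<^sup>+u. emeasure (?E k) {v. v + u \<in> {..y}} \<partial>?E h)"
    by (rule convolution_emeasure) (auto intro: fin)
  also have "\<dots> = (\<integral>\<^sup>+u. ennreal (erlang_sum_CDF N \<beta> (y - u)) \<partial>?E h)"
  proof (rule nn_integral_cong)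
    fix u
    have "{v. v + u \<in> {..y}} = {..y - u}" by auto
    thus "emeasure (?E k) {v. v + u \<in> {..y}} = ennreal (erlang_sum_CDF N \<beta> (y - u))"
      using Suc emeasure_erlang_density[OF assms, of k "y - u"] by (simp add: erlang_sum_CDF_def)
  qed
  also have "\<dots> = (\<integral>\<^sup>+u. ennreal (erlang_density h \<beta> u) * ennreal (erlang_sum_CDF N \<beta> (y - u)) \<partial>lborel)"
    by (rule nn_integral_density) auto
  finally show ?thesis ..
qed

text \<open>
  Integration over the part of a mixed Erlang distribution above \<open>d\<close>, written in terms of the excess.
\<close>

lemma nn_integral_ME_exceedance:
  assumes "0 < \<beta>" "mixing_vector q" "0 \<le> d" and [measurable]: "f \<in> borel_measurable borel"
  shows "(\<integral>\<^sup>+u. indicator {d<..} u * f (u - d) \<partial>ME \<beta> q) =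
    (\<integral>\<^sup>+v. (\<Sum>h. ennreal (me_Delta h d \<beta> q) * (ennreal (erlang_density h \<beta> v) * f v)) \<partial>lborel)"
proof -
  have "(\<integral>\<^sup>+u. indicator {d<..} u * f (u - d) \<partial>ME \<beta> q) =
      (\<integral>\<^sup>+u. me_dens \<beta> q u * (indicator {d<..} u * f (u - d)) \<partial>lborel)"
    unfolding ME_eq_density_me_dens[OF assms(1,2)] by (rule nn_integral_density) auto
  also have "\<dots> = (\<integral>\<^sup>+v. me_dens \<beta> q (d + v) * (indicator {d<..} (d + v) * f v) \<partial>lborel)"
    by (subst nn_integral_real_affine[where c=1 and t=d]) auto
  also have "\<dots> = (\<integral>\<^sup>+v. (\<Sum>h. ennreal (me_Delta h d \<beta> q) * (ennreal (erlang_density h \<beta> v) * f v)) \<partial>lborel)"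
  proof (rule nn_integral_cong_AE)
    \<comment> \<open>At \<open>v = 0\<close> the two integrands differ: the threshold is exceeded strictly, but the first Erlang density is positive there.\<close>
    show "AE v in lborel. me_dens \<beta> q (d + v) * (indicator {d<..} (d + v) * f v) =
        (\<Sum>h. ennreal (me_Delta h d \<beta> q) * (ennreal (erlang_density h \<beta> v) * f v))"
      using AE_lborel_singleton[of "0::real"]
    proof eventually_elim
      case (elim v)
      show ?case
      proof (cases "v < 0")
        case False
        with elim have v: "0 < v" by simp
        have "(\<Sum>h. ennreal (me_Delta h d \<beta> q) * (ennreal (erlang_density h \<beta> v) * f v)) = me_dens \<beta> q (d + v) * f v"
          using v assms by (simp add: me_dens_add mult.assoc[symmetric])
        thus ?thesis using v by simp
      qed (simp add: erlang_density_def)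
    qed
  qed
  finally show ?thesis .
qed

text \<open>
  The probability that independent variables all exceed their thresholds with total excess at most \<open>y\<close>.
  Integrating out one variable leaves the same probability for the others with \<open>y\<close> lowered by its
  excess \<open>v\<close>; the excess has density \<open>\<Sum>h. \<Delta>\<^sub>h w\<^sub>h\<^sub>+\<^sub>1(v)\<close>, and convolving \<open>w\<^sub>h\<^sub>+\<^sub>1\<close> with the distribution function
  of \<open>N\<close> exponential variables yields the one of \<open>N + h + 1\<close>.
\<close>

lemma exceedance_probability:
  fixes P :: "nat \<Rightarrow> nat \<Rightarrow> real" and d :: "nat \<Rightarrow> real"
  assumes \<beta>: "0 < \<beta>" and P: "\<And>i. mixing_vector (P i)" and d: "\<And>i. i \<in> set js \<Longrightarrow> 0 \<le> d i" and js: "distinct js"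
  shows "(\<integral>\<^sup>+x. (\<Prod>j\<in>set js. indicator {d j<..} (x j)) * indicator {..y} (\<Sum>j\<in>set js. x j - d j)
      \<partial>PiM (set js) (\<lambda>i. ME \<beta> (P i))) =
    iterated_esuminf (length js) (\<lambda>hs. (\<Prod>i<length js. ennreal (me_Delta (hs ! i) (d (js ! i)) \<beta> (P (js ! i)))) *
      ennreal (erlang_sum_CDF (sum_list hs + length js) \<beta> y))"
  using d js
proof (induction js arbitrary: y)
  case Nil
  show ?case by (simp add: PiM_empty nn_integral_count_space_finite erlang_sum_CDF_def indicator_def)
next
  case (Cons j js)
  interpret product_sigma_finite "\<lambda>i. ME \<beta> (P i)"
    unfolding product_sigma_finite_def
    using prob_space_ME[OF \<beta> P] prob_space_imp_sigma_finite by blast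
  note Cons.prems[simp]
  let ?\<mu> = "\<lambda>i. ME \<beta> (P i)"
  let ?c = "\<lambda>hs. \<Prod>i<length js. ennreal (me_Delta (hs ! i) (d (js ! i)) \<beta> (P (js ! i)))"
  let ?W = "\<lambda>N y. ennreal (erlang_sum_CDF N \<beta> y)"
  let ?G = "\<lambda>y. \<integral>\<^sup>+x. (\<Prod>j\<in>set js. indicator {d j<..} (x j)) * indicator {..y} (\<Sum>j\<in>set js. x j - d j) \<partial>PiM (set js) ?\<mu>"
  let ?I = "\<lambda>y. iterated_esuminf (length js) (\<lambda>hs. ?c hs * ?W (sum_list hs + length js) y)"
  have IH: "?G y = ?I y" for y
    using Cons.prems by (intro Cons.IH) auto
  have [measurable]: "?I \<in> borel_measurable borel"
    by (rule borel_measurable_iterated_esuminf) measurable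
  have [simp]: "j \<notin> set js" using Cons.prems by simp
  have upd: "(\<Prod>i\<in>set js. indicator {d i<..} ((x(j := u)) i)) = (\<Prod>i\<in>set js. indicator {d i<..} (x i) :: ennreal)"
     "(\<Sum>i\<in>set js. (x(j := u)) i - d i) = (\<Sum>i\<in>set js. x i - d i)" for x and u :: real
    by (auto intro!: prod.cong sum.cong)
  have conv: "(\<integral>\<^sup>+v. ennreal (erlang_density h \<beta> v) * ?I (y - v) \<partial>lborel) =
      iterated_esuminf (length js) (\<lambda>hs. ?c hs * ?W (Suc h + (sum_list hs + length js)) y)" for h
  proof -
    have "(\<integral>\<^sup>+v. ennreal (erlang_density h \<beta> v) * ?I (y - v) \<partial>lborel) =
      (\<integral>\<^sup>+v. iterated_esuminf (length js) (\<lambda>hs. ?c hs * (ennreal (erlang_density h \<beta> v) * ?W (sum_list hs + length js) (y - v))) \<partial>lborel)"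
      unfolding iterated_esuminf_cmult[symmetric] by (simp add: mult_ac)
    also have "\<dots> = iterated_esuminf (length js) (\<lambda>hs. \<integral>\<^sup>+v. ?c hs * (ennreal (erlang_density h \<beta> v) * ?W (sum_list hs + length js) (y - v)) \<partial>lborel)"
      by (rule nn_integral_iterated_esuminf) measurable
    \<comment> \<open>Convolution adds the shape of the new variable to that of the others.\<close>
    also have "\<dots> = iterated_esuminf (length js) (\<lambda>hs. ?c hs * ?W (Suc h + (sum_list hs + length js)) y)"
      by (subst nn_integral_cmult) (auto simp only: erlang_sum_CDF_convolution[OF \<beta>], measurable)
    finally show ?thesis .
  qed
  have "(\<integral>\<^sup>+x. (\<Prod>j\<in>set (j # js). indicator {d j<..} (x j)) * indicator {..y} (\<Sum>j\<in>set (j # js). x j - d j)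
      \<partial>PiM (set (j # js)) ?\<mu>) = (\<integral>\<^sup>+u. (\<integral>\<^sup>+x. (\<Prod>i\<in>insert j (set js). indicator {d i<..} ((x(j := u)) i)) *
         indicator {..y} (\<Sum>i\<in>insert j (set js). (x(j := u)) i - d i) \<partial>PiM (set js) ?\<mu>) \<partial>?\<mu> j)"
    unfolding list.set by (rule product_nn_integral_insert_rev) auto
  also have "\<dots> = (\<integral>\<^sup>+u. indicator {d j<..} u * ?G (y - (u - d j)) \<partial>?\<mu> j)"
  proof (rule nn_integral_cong)
    fix u
    have "(\<integral>\<^sup>+x. (\<Prod>i\<in>insert j (set js). indicator {d i<..} ((x(j := u)) i)) *
         indicator {..y} (\<Sum>i\<in>insert j (set js). (x(j := u)) i - d i) \<partial>PiM (set js) ?\<mu>) =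
      (\<integral>\<^sup>+x. indicator {d j<..} u * ((\<Prod>i\<in>set js. indicator {d i<..} (x i)) *
         indicator {..y - (u - d j)} (\<Sum>i\<in>set js. x i - d i)) \<partial>PiM (set js) ?\<mu>)"
      by (intro nn_integral_cong) (simp add: upd del: fun_upd_apply, auto simp: indicator_def)
    also have "\<dots> = indicator {d j<..} u * ?G (y - (u - d j))"
      by (rule nn_integral_cmult) measurable
    finally show "(\<integral>\<^sup>+x. (\<Prod>i\<in>insert j (set js). indicator {d i<..} ((x(j := u)) i)) *
         indicator {..y} (\<Sum>i\<in>insert j (set js). (x(j := u)) i - d i) \<partial>PiM (set js) ?\<mu>) = indicator {d j<..} u * ?G (y - (u - d j))" .
  qed
  also have "\<dots> = (\<integral>\<^sup>+u. indicator {d j<..} u * ?I (y - (u - d j)) \<partial>?\<mu> j)"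
    unfolding IH ..
  also have "\<dots> = (\<integral>\<^sup>+v. (\<Sum>h. ennreal (me_Delta h (d j) \<beta> (P j)) * (ennreal (erlang_density h \<beta> v) * ?I (y - v))) \<partial>lborel)"
    by (rule nn_integral_ME_exceedance[OF \<beta> P, where f="\<lambda>v. ?I (y - v)"]) (auto simp: Cons.prems)
  also have "\<dots> = (\<Sum>h. ennreal (me_Delta h (d j) \<beta> (P j)) * (\<integral>\<^sup>+v. ennreal (erlang_density h \<beta> v) * ?I (y - v) \<partial>lborel))"
    by (simp add: nn_integral_suminf nn_integral_cmult)
  also have "\<dots> = (\<Sum>h. ennreal (me_Delta h (d j) \<beta> (P j)) *
      iterated_esuminf (length js) (\<lambda>hs. ?c hs * ?W (Suc h + (sum_list hs + length js)) y))"
    unfolding conv ..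
  also have "\<dots> = iterated_esuminf (length (j # js)) (\<lambda>hs. (\<Prod>i<length (j # js). ennreal (me_Delta (hs ! i) (d ((j # js) ! i)) \<beta> (P ((j # js) ! i)))) *
      ?W (sum_list hs + length (j # js)) y)"
    unfolding iterated_esuminf_cmult[symmetric]
    by (simp add: prod.lessThan_Suc_shift mult_ac add_ac del: prod.lessThan_Suc)
  finally show ?case .
qed

text \<open>
  The conditions on the variables in \<open>js\<close> and on the remaining ones concern disjoint sets of coordinates,
  and each remaining coordinate contributes one factor.
\<close>

lemma exceedance_event_probability:
  fixes P :: "nat \<Rightarrow> nat \<Rightarrow> real" and d :: "nat \<Rightarrow> real"
  assumes \<beta>: "0 < \<beta>" and P: "\<And>i. i \<in> I \<Longrightarrow> mixing_vector (P i)" and d: "\<And>i. i \<in> I \<Longrightarrow> 0 \<le> d i"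
    and js: "distinct js" "set js \<subseteq> I" "js \<noteq> []" and I: "finite I"
  shows "measure (PiM I (\<lambda>i. ME \<beta> (P i)))
     {x \<in> space (PiM I (\<lambda>i. borel)). (\<forall>j\<in>set js. d j < x j) \<and> (\<forall>i\<in>I - set js. x i \<le> d i) \<and> (\<Sum>j\<in>set js. x j - d j) \<le> y} =
    me_H \<beta> (map P js) y (map d js) * (\<Prod>i\<in>I - set js. cdf (ME \<beta> (P i)) (d i))"
proof -
  \<comment> \<open>Product measures below need a probability distribution at every index, so \<open>P\<close> is extended beyond \<open>I\<close>.\<close>
  define q where "q = (\<lambda>i. if i \<in> I then P i else P (hd js))"
  have hd: "hd js \<in> I" using js by (cases js) auto
  have q: "mixing_vector (q i)" for i using P hd by (simp add: q_def)
  let ?\<mu> = "\<lambda>i. ME \<beta> (q i)"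
  interpret pr: prob_space "?\<mu> i" for i by (rule prob_space_ME[OF \<beta> q])
  interpret product_prob_space ?\<mu> ..
  let ?J = "set js" and ?K = "I - set js"
  let ?A = "{x \<in> space (PiM I (\<lambda>i. borel)). (\<forall>j\<in>?J. d j < x j) \<and> (\<forall>i\<in>?K. x i \<le> d i) \<and> (\<Sum>j\<in>?J. x j - d j) \<le> y}"
  let ?f = "\<lambda>x. (\<Prod>j\<in>?J. indicator {d j<..} (x j)) * indicator {..y} (\<Sum>j\<in>?J. x j - d j) :: ennreal"
  let ?g = "\<lambda>x. \<Prod>i\<in>?K. indicator {..d i} (x i) :: ennreal"
  let ?F = "\<lambda>hs. (\<Prod>i<length js. me_Delta (hs ! i) (map d js ! i) \<beta> (map P js ! i)) * erlang_CDF (sum_list hs + length js - 1) \<beta> y"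
  have IJ: "?J \<union> ?K = I" using js by auto
  have [simp]: "finite I" by (rule I)
  have PiM: "PiM I (\<lambda>i. ME \<beta> (P i)) = PiM I ?\<mu>"
    by (intro PiM_cong) (auto simp: q_def)
  have sp: "space (PiM I (\<lambda>i. borel)) = space (PiM I ?\<mu>)" by (simp add: space_PiM)
  have A: "?A \<in> sets (PiM I ?\<mu>)" unfolding sp
    using js by (intro sets.sets_Collect sets_Collect_single) (auto simp: subset_iff)
  have ind: "indicator ?A x = ?f x * ?g x" if "x \<in> space (PiM I ?\<mu>)" for x
    using that I unfolding sp by (subst (1 2) prod_indicator) (auto simp: indicator_def)
  have "(\<integral>\<^sup>+x. ?f x \<partial>PiM ?J ?\<mu>) = iterated_esuminf (length js) (\<lambda>hs. (\<Prod>i<length js. ennreal (me_Delta (hs ! i) (d (js ! i)) \<beta> (q (js ! i)))) *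
      ennreal (erlang_sum_CDF (sum_list hs + length js) \<beta> y))"
    using js d by (intro exceedance_probability \<beta> q) auto
  also have "\<dots> = iterated_esuminf (length js) (\<lambda>hs. ennreal (?F hs))"
  proof (rule iterated_esuminf_cong)
    fix hs :: "nat list"
    have "(\<Prod>i<length js. ennreal (me_Delta (hs ! i) (d (js ! i)) \<beta> (q (js ! i)))) =
      ennreal (\<Prod>i<length js. me_Delta (hs ! i) (d (js ! i)) \<beta> (q (js ! i)))"
      by (intro prod_ennreal) (auto intro!: me_Delta_nonneg \<beta> q)
    also have "(\<Prod>i<length js. me_Delta (hs ! i) (d (js ! i)) \<beta> (q (js ! i))) =
      (\<Prod>i<length js. me_Delta (hs ! i) (map d js ! i) \<beta> (map P js ! i))"
      using js by (intro prod.cong) (auto simp: q_def subset_iff)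
    finally show "(\<Prod>i<length js. ennreal (me_Delta (hs ! i) (d (js ! i)) \<beta> (q (js ! i)))) *
      ennreal (erlang_sum_CDF (sum_list hs + length js) \<beta> y) = ennreal (?F hs)"
      using js \<beta> by (simp add: erlang_sum_CDF_def ennreal_mult'' erlang_CDF_nonneg)
  qed
  finally have F: "(\<integral>\<^sup>+x. ?f x \<partial>PiM ?J ?\<mu>) = iterated_esuminf (length js) (\<lambda>hs. ennreal (?F hs))" .
  \<comment> \<open>The iterated series is a probability, hence finite, so its real counterpart converges.\<close>
  have "(\<integral>\<^sup>+x. ?f x \<partial>PiM ?J ?\<mu>) \<le> (\<integral>\<^sup>+x. 1 \<partial>PiM ?J ?\<mu>)"
    by (intro nn_integral_mono mult_le_one prod_le_1) (auto simp: indicator_def)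
  also have "\<dots> = 1"
    using prob_space.emeasure_space_1[OF prob_space_PiM[of ?J ?\<mu>]] pr.prob_space_axioms by simp
  finally have fin: "iterated_esuminf (length js) (\<lambda>hs. ennreal (?F hs)) \<noteq> \<top>"
    unfolding F by (auto simp: top_unique)
  have jI: "js ! i \<in> I" if "i < length js" for i
    using that js nth_mem by blast
  have "0 \<le> ?F hs" if "length hs = length js" for hs
  proof (intro mult_nonneg_nonneg prod_nonneg erlang_CDF_nonneg \<beta>)
    fix i assume "i \<in> {..<length js}"
    thus "0 \<le> me_Delta (hs ! i) (map d js ! i) \<beta> (map P js ! i)"
      using me_Delta_nonneg[OF \<beta> assms(2)[OF jI]] by simp
  qed
  from iterated_esuminf_ennreal[of "length js" ?F, OF this fin]
  have H: "0 \<le> me_H \<beta> (map P js) y (map d js)"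
    "iterated_esuminf (length js) (\<lambda>hs. ennreal (?F hs)) = ennreal (me_H \<beta> (map P js) y (map d js))"
    by (simp_all add: me_H_def)
  have "emeasure (PiM I ?\<mu>) ?A = (\<integral>\<^sup>+x. ?f x * ?g x \<partial>PiM I ?\<mu>)"
    using A by (subst nn_integral_indicator[symmetric]) (auto intro!: nn_integral_cong simp: ind simp del: nn_integral_indicator)
  also have "\<dots> = (\<integral>\<^sup>+x. (\<integral>\<^sup>+z. ?f (merge ?J ?K (x, z)) * ?g (merge ?J ?K (x, z)) \<partial>PiM ?K ?\<mu>) \<partial>PiM ?J ?\<mu>)"
    using product_nn_integral_fold[of ?J ?K "\<lambda>x. ?f x * ?g x"] js unfolding IJ by (auto simp: subset_iff)
  also have "\<dots> = (\<integral>\<^sup>+x. (\<integral>\<^sup>+z. ?f x * ?g z \<partial>PiM ?K ?\<mu>) \<partial>PiM ?J ?\<mu>)"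
    by (intro nn_integral_cong) (simp add: merge_def)
  also have "\<dots> = (\<integral>\<^sup>+x. ?f x \<partial>PiM ?J ?\<mu>) * (\<integral>\<^sup>+z. ?g z \<partial>PiM ?K ?\<mu>)"
    by (simp add: nn_integral_cmult nn_integral_multc)
  also have "(\<integral>\<^sup>+z. ?g z \<partial>PiM ?K ?\<mu>) = (\<Prod>i\<in>?K. emeasure (?\<mu> i) {..d i})"
    by (subst product_nn_integral_prod) auto
  also have "\<dots> = ennreal (\<Prod>i\<in>?K. cdf (?\<mu> i) (d i))"
    by (simp add: pr.emeasure_eq_measure cdf_def prod_ennreal)
  finally have *: "emeasure (PiM I ?\<mu>) ?A = ennreal (me_H \<beta> (map P js) y (map d js)) * ennreal (\<Prod>i\<in>?K. cdf (?\<mu> i) (d i))"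
    unfolding F H(2) .
  have c: "0 \<le> (\<Prod>i\<in>?K. cdf (?\<mu> i) (d i))"
    by (intro prod_nonneg) (simp add: cdf_def)
  have "measure (PiM I ?\<mu>) ?A = me_H \<beta> (map P js) y (map d js) * (\<Prod>i\<in>?K. cdf (?\<mu> i) (d i))"
    unfolding measure_def * using c H(1) by (simp add: ennreal_mult[symmetric])
  also have "(\<Prod>i\<in>?K. cdf (?\<mu> i) (d i)) = (\<Prod>i\<in>?K. cdf (ME \<beta> (P i)) (d i))"
    by (intro prod.cong) (auto simp: q_def)
  finally show ?thesis unfolding PiM .
qed

section \<open>Sums over blocks of independent variables\<close>

text \<open>
  A product of densities is the density of the product measure: both measures agree on boxes.
\<close>

lemma density_PiM_lborel:
  fixes f :: "'i \<Rightarrow> real \<Rightarrow> ennreal"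
  assumes I: "finite I" and [measurable]: "\<And>i. i \<in> I \<Longrightarrow> f i \<in> borel_measurable borel"
    and fin: "\<And>i. i \<in> I \<Longrightarrow> finite_measure (density lborel (f i))"
  shows "density (PiM I (\<lambda>_. lborel)) (\<lambda>x. \<Prod>i\<in>I. f i (x i)) = PiM I (\<lambda>i. density lborel (f i))"
proof -
  \<comment> \<open>Uniqueness of product measures is stated for families that are sigma-finite at every index.\<close>
  define g where "g = (\<lambda>i. if i \<in> I then f i else (\<lambda>_. 0))"
  have g [measurable]: "g i \<in> borel_measurable borel" for i by (simp add: g_def)
  have "finite_measure (density lborel (g i))" for i
    using fin by (auto simp: g_def intro!: finite_measureI simp: emeasure_density)
  then interpret G: product_sigma_finite "\<lambda>i. density lborel (g i)"
    unfolding product_sigma_finite_def finite_measure_def by blast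
  interpret L: product_sigma_finite "\<lambda>_. lborel :: real measure"
    by standard
  have "density (PiM I (\<lambda>_. lborel)) (\<lambda>x. \<Prod>i\<in>I. g i (x i)) = PiM I (\<lambda>i. density lborel (g i))"
  proof (rule G.PiM_eqI[OF I])
    show "sets (density (PiM I (\<lambda>_. lborel)) (\<lambda>x. \<Prod>i\<in>I. g i (x i))) = sets (PiM I (\<lambda>i. density lborel (g i)))"
      by (simp cong: sets_PiM_cong)
  next
    fix A assume "\<And>i. i \<in> I \<Longrightarrow> A i \<in> sets (density lborel (g i))"
    hence A: "\<And>i. i \<in> I \<Longrightarrow> A i \<in> sets borel" by simp
    hence S: "Pi\<^sub>E I A \<in> sets (PiM I (\<lambda>_. lborel))" using I by (intro sets_PiM_I_finite) auto
    have ind: "indicator (Pi\<^sub>E I A) x = (\<Prod>i\<in>I. indicator (A i) (x i) :: ennreal)"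
      if "x \<in> space (PiM I (\<lambda>_. lborel))" for x
      using that I by (subst prod_indicator) (auto simp: space_PiM indicator_def PiE_iff)
    have "emeasure (density (PiM I (\<lambda>_. lborel)) (\<lambda>x. \<Prod>i\<in>I. g i (x i))) (Pi\<^sub>E I A) =
      (\<integral>\<^sup>+x. (\<Prod>i\<in>I. g i (x i) * indicator (A i) (x i)) \<partial>PiM I (\<lambda>_. lborel))"
      using S by (subst emeasure_density) (auto intro!: nn_integral_cong simp: ind prod.distrib)
    also have "\<dots> = (\<Prod>i\<in>I. \<integral>\<^sup>+x. g i x * indicator (A i) x \<partial>lborel)"
      using I A by (intro L.product_nn_integral_prod) auto
    also have "\<dots> = (\<Prod>i\<in>I. emeasure (density lborel (g i)) (A i))"
      using A by (intro prod.cong refl) (simp add: emeasure_density)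
    finally show "emeasure (density (PiM I (\<lambda>_. lborel)) (\<lambda>x. \<Prod>i\<in>I. g i (x i))) (Pi\<^sub>E I A) =
      (\<Prod>i\<in>I. emeasure (density lborel (g i)) (A i))" .
  qed
  also have "PiM I (\<lambda>i. density lborel (g i)) = PiM I (\<lambda>i. density lborel (f i))"
    by (intro PiM_cong) (auto simp: g_def)
  also have "(\<lambda>x. \<Prod>i\<in>I. g i (x i)) = (\<lambda>x. \<Prod>i\<in>I. f i (x i))"
    by (auto simp: g_def intro!: prod.cong)
  finally show ?thesis .
qed

lemma indep_vars_PiM_coordinates:
  assumes \<mu>: "\<And>i. i \<in> I \<Longrightarrow> prob_space (\<mu> i)" and s: "\<And>i. i \<in> I \<Longrightarrow> sets (\<mu> i) = sets borel" and I: "I \<noteq> {}"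
  shows "prob_space.indep_vars (PiM I \<mu>) (\<lambda>_. borel) (\<lambda>i x. x i) I"
    "\<And>i. i \<in> I \<Longrightarrow> distr (PiM I \<mu>) borel (\<lambda>x. x i) = \<mu> i"
proof -
  have c: "distr (PiM I \<mu>) borel (\<lambda>x. x i) = \<mu> i" if "i \<in> I" for i
  proof -
    have "distr (PiM I \<mu>) borel (\<lambda>x. x i) = distr (PiM I \<mu>) (\<mu> i) (\<lambda>x. x i)"
      using s[OF that] by (intro distr_cong) auto
    also have "\<dots> = \<mu> i" by (rule distr_PiM_component[OF \<mu> that])
    finally show ?thesis .
  qed
  thus "\<And>i. i \<in> I \<Longrightarrow> distr (PiM I \<mu>) borel (\<lambda>x. x i) = \<mu> i" .
  interpret prob_space "PiM I \<mu>" by (rule prob_space_PiM[OF \<mu>])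
  have rv: "random_variable borel (\<lambda>x. x i)" if "i \<in> I" for i
    using measurable_component_singleton[OF that, of \<mu>] s[OF that] measurable_cong_sets[OF refl s[OF that]] by blast
  have "distr (PiM I \<mu>) (PiM I (\<lambda>_. borel)) (\<lambda>x. \<lambda>i\<in>I. x i) = distr (PiM I \<mu>) (PiM I \<mu>) (\<lambda>x. x)"
    using s by (intro distr_cong sets_PiM_cong) (auto simp: space_PiM PiE_restrict)
  also have "\<dots> = PiM I (\<lambda>i. distr (PiM I \<mu>) borel (\<lambda>x. x i))"
    using c by (simp add: distr_id2 cong: PiM_cong)
  finally show "indep_vars (\<lambda>_. borel) (\<lambda>i x. x i) I"
    by (subst indep_vars_iff_distr_eq_PiM'[OF I rv])
qed

text \<open>
  Sums over disjoint blocks of independent variables are independent. Within a block the summands are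
  added one at a time, and each addition is a convolution of mixing vectors.
\<close>

lemma distr_block_sums:
  fixes qs :: "nat \<Rightarrow> nat \<Rightarrow> nat \<Rightarrow> real"
  assumes \<beta>: "0 < \<beta>" and I: "I \<noteq> {}" and k: "\<And>i. i \<in> I \<Longrightarrow> 1 \<le> k i"
    and qs: "\<And>i j. i \<in> I \<Longrightarrow> j \<in> {1..k i} \<Longrightarrow> mixing_vector (qs i j)"
  shows "distr (PiM (SIGMA i:I. {1..k i}) (\<lambda>(i, j). ME \<beta> (qs i j))) (PiM I (\<lambda>_. borel))
      (\<lambda>x. \<lambda>i\<in>I. \<Sum>j=1..k i. x (i, j)) = PiM I (\<lambda>i. ME \<beta> (mix_Pi (qs i) (k i)))"
proof -
  let ?K = "SIGMA i:I. {1..k i}" and ?\<mu> = "\<lambda>(i, j). ME \<beta> (qs i j)"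
  let ?N = "PiM ?K ?\<mu>" and ?S = "\<lambda>i x. \<Sum>j=1..k i. x (i, j)"
  have \<mu>: "prob_space (?\<mu> p)" "sets (?\<mu> p) = sets borel" if "p \<in> ?K" for p
    using that qs \<beta> by (auto intro!: prob_space_ME)
  obtain i0 where i0: "i0 \<in> I" using I by blast
  hence "(i0, 1) \<in> ?K" using k by auto
  hence Kne: "?K \<noteq> {}" by blast
  interpret N: prob_space ?N by (rule prob_space_PiM[OF \<mu>(1)])
  have ind1: "N.indep_vars (\<lambda>_. borel) (\<lambda>p x. x p) ?K"
    by (rule indep_vars_PiM_coordinates(1)[OF \<mu> Kne])
  have ind2: "distr ?N borel (\<lambda>x. x p) = ?\<mu> p" if "p \<in> ?K" for p
    by (rule indep_vars_PiM_coordinates(2)[OF \<mu> Kne that])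
  have rv: "(\<lambda>x. x p) \<in> borel_measurable ?N" if "p \<in> ?K" for p
    using ind1 that unfolding N.indep_vars_def by blast
  have S_rv: "(\<lambda>x. \<Sum>j=1..m. x (i, j)) \<in> borel_measurable ?N" if "i \<in> I" "m \<le> k i" for i m
    using that by (intro borel_measurable_sum rv) auto
  have "N.indep_vars (\<lambda>i. PiM ({i} \<times> {1..k i}) (\<lambda>_. borel)) (\<lambda>i x. restrict (\<lambda>p. x p) ({i} \<times> {1..k i})) I"
    by (rule N.indep_vars_restrict[OF ind1]) (auto simp: disjoint_family_on_def)
  hence "N.indep_vars (\<lambda>_. borel) (\<lambda>i x. \<Sum>j=1..k i. restrict (\<lambda>p. x p) ({i} \<times> {1..k i}) (i, j)) I"
    by (rule N.indep_vars_compose2[where Y="\<lambda>i f. \<Sum>j=1..k i. f (i, j)"])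
       (intro borel_measurable_sum measurable_component_singleton, auto)
  also have "(\<lambda>i x. \<Sum>j=1..k i. restrict (\<lambda>p. x p) ({i} \<times> {1..k i}) (i, j)) = ?S"
    by (intro ext sum.cong) auto
  finally have S_ind: "N.indep_vars (\<lambda>_. borel) ?S I" .
  have "distr ?N (PiM I (\<lambda>_. borel)) (\<lambda>x. \<lambda>i\<in>I. ?S i x) = PiM I (\<lambda>i. distr ?N borel (?S i))"
    by (rule N.indep_vars_iff_distr_eq_PiM'[OF I, THEN iffD1, OF S_rv[OF _ order_refl] S_ind])
  also have "\<dots> = PiM I (\<lambda>i. ME \<beta> (mix_Pi (qs i) (k i)))"
  proof (rule PiM_cong[OF refl])
    fix i assume i: "i \<in> I"
    have "distr ?N borel (\<lambda>x. \<Sum>j=1..m. x (i, j)) = ME \<beta> (mix_Pi (qs i) m)" if "0 < m" "m \<le> k i" for m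
      using that
    proof (induction m rule: nat_induct_non_zero)
      case 1
      thus ?case using ind2[of "(i, 1)"] i k[OF i] by simp
    next
      case (Suc m)
      let ?J = "Pair i ` {1..m}"
      have sub: "insert (i, Suc m) ?J \<subseteq> ?K" using i Suc by auto
      have "N.indep_var borel (\<lambda>x. x (i, Suc m)) borel (\<lambda>x. \<Sum>p\<in>?J. x p)"
        by (rule N.indep_vars_sum[OF _ _ N.indep_vars_subset[OF ind1 sub]]) auto
      hence iv: "N.indep_var borel (\<lambda>x. x (i, Suc m)) borel (\<lambda>x. \<Sum>j=1..m. x (i, j))"
        by (simp add: sum.reindex inj_on_def)
      have mv: "mixing_vector (mix_Pi (qs i) m)" "mixing_vector (qs i (Suc m))"
        using Suc i by (auto intro!: mixing_vector_mix_Pi qs)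
      have eq: "(\<lambda>x. \<Sum>j=1..Suc m. x (i, j)) = (\<lambda>x. x (i, Suc m) + (\<Sum>j=1..m. x (i, j)))"
        by (auto simp: add.commute)
      have "distr ?N borel (\<lambda>x. \<Sum>j=1..Suc m. x (i, j)) =
          (distr ?N borel (\<lambda>x. x (i, Suc m)) \<star> distr ?N borel (\<lambda>x. \<Sum>j=1..m. x (i, j)))"
        unfolding eq using sub Suc i by (intro N.sum_indep_random_variable[OF iv] rv S_rv) simp_all
      also have "distr ?N borel (\<lambda>x. x (i, Suc m)) = ME \<beta> (qs i (Suc m))"
        using ind2[of "(i, Suc m)"] Suc i by simp
      also have "distr ?N borel (\<lambda>x. \<Sum>j=1..m. x (i, j)) = ME \<beta> (mix_Pi (qs i) m)"
        using Suc by simp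
      also have "(ME \<beta> (qs i (Suc m)) \<star> ME \<beta> (mix_Pi (qs i) m)) = (ME \<beta> (mix_Pi (qs i) m) \<star> ME \<beta> (qs i (Suc m)))"
        using mv \<beta> by (intro convolution_commutative) (auto intro!: prob_space.finite_measure prob_space_ME)
      also have "\<dots> = ME \<beta> (mix_Pi (qs i) (Suc m))"
        using convolution_mix_Pi(1)[OF \<beta> mv] Suc by simp
      finally show ?case .
    qed
    thus "distr ?N borel (?S i) = ME \<beta> (mix_Pi (qs i) (k i))"
      using k[OF i] by simp
  qed
  finally show ?thesis .
qed

text \<open>
  Raising all scales to \<open>B\<close> first makes the block sums mixed Erlang with one common scale, as
  \<open>H\<close> requires.
\<close>

lemma block_exceedance_probability:
  fixes b :: "nat \<Rightarrow> nat \<Rightarrow> real" and r :: "nat \<Rightarrow> nat \<Rightarrow> nat \<Rightarrow> real"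
  assumes I: "finite I" and k: "\<And>i. i \<in> I \<Longrightarrow> 1 \<le> k i"
    and br: "\<And>i j. i \<in> I \<Longrightarrow> j \<in> {1..k i} \<Longrightarrow> 0 < b i j \<and> b i j \<le> B \<and> mixing_vector (r i j)"
    and d: "\<And>i. i \<in> I \<Longrightarrow> 0 \<le> d i"
    and js: "distinct js" "set js \<subseteq> I" "js \<noteq> []"
  defines "P \<equiv> \<lambda>i. mix_Pi (\<lambda>l. mix_Psi (b i l) B (r i l)) (k i)"
  shows "measure (PiM (SIGMA i:I. {1..k i}) (\<lambda>(i, j). ME (b i j) (r i j)))
     {x \<in> space (PiM (SIGMA i:I. {1..k i}) (\<lambda>_. borel)).
       (\<forall>j\<in>set js. d j < (\<Sum>l=1..k j. x (j, l))) \<and> (\<forall>i\<in>I - set js. (\<Sum>l=1..k i. x (i, l)) \<le> d i) \<and>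
       (\<Sum>j\<in>set js. (\<Sum>l=1..k j. x (j, l)) - d j) \<le> y} =
    me_H B (map P js) y (map d js) * (\<Prod>i\<in>I - set js. cdf (ME B (P i)) (d i))"
proof -
  let ?K = "SIGMA i:I. {1..k i}"
  let ?N = "PiM ?K (\<lambda>(i, j). ME (b i j) (r i j))" and ?N' = "PiM ?K (\<lambda>(i, j). ME B (mix_Psi (b i j) B (r i j)))"
  let ?S = "\<lambda>x. \<lambda>i\<in>I. \<Sum>j=1..k i. x (i, j)"
  let ?A = "{x \<in> space (PiM I (\<lambda>i. borel)). (\<forall>j\<in>set js. d j < x j) \<and> (\<forall>i\<in>I - set js. x i \<le> d i) \<and> (\<Sum>j\<in>set js. x j - d j) \<le> y}"
  let ?E = "{x \<in> space (PiM ?K (\<lambda>_. borel)).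
       (\<forall>j\<in>set js. d j < (\<Sum>l=1..k j. x (j, l))) \<and> (\<forall>i\<in>I - set js. (\<Sum>l=1..k i. x (i, l)) \<le> d i) \<and>
       (\<Sum>j\<in>set js. (\<Sum>l=1..k j. x (j, l)) - d j) \<le> y}"
  obtain i0 where i0: "i0 \<in> I" using js by (cases js) auto
  have B: "0 < B" using br[of i0 1] k[OF i0] i0 by force
  have NN: "?N = ?N'"
    using br by (intro PiM_cong) (auto simp: ME_mix_Psi)
  have [measurable_cong]: "sets ?N' = sets (PiM ?K (\<lambda>_. borel))"
    by (intro sets_PiM_cong) auto
  have S: "?S \<in> ?N' \<rightarrow>\<^sub>M PiM I (\<lambda>_. borel)"
    by measurable
  have A: "?A \<in> sets (PiM I (\<lambda>_. borel))"
    using js I by (intro sets.sets_Collect sets_Collect_single) (auto simp: subset_iff)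
  have "?S -` ?A \<inter> space ?N' = ?E"
    using js by (auto simp: space_PiM subset_iff cong: sum.cong conj_cong)
  hence "measure ?N' ?E = measure (distr ?N' (PiM I (\<lambda>_. borel)) ?S) ?A"
    using S A by (simp add: measure_distr)
  also have "distr ?N' (PiM I (\<lambda>_. borel)) ?S = PiM I (\<lambda>i. ME B (P i))"
    unfolding P_def using br k i0 by (intro distr_block_sums B) (auto intro!: mixing_vector_mix_Psi)
  also have "measure (PiM I (\<lambda>i. ME B (P i))) ?A =
      me_H B (map P js) y (map d js) * (\<Prod>i\<in>I - set js. cdf (ME B (P i)) (d i))"
  proof (rule exceedance_event_probability[OF B _ d js I])
    fix i assume "i \<in> I"
    thus "mixing_vector (P i)"
      unfolding P_def using br k[of i] by (intro mixing_vector_mix_Pi mixing_vector_mix_Psi) auto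
  qed
  finally show ?thesis unfolding NN .
qed

section \<open>Expansion of the Sarmanov density\<close>

text \<open>
  The density of independent variables where each \<open>p \<in> D\<close> follows the normalised square
  \<open>f\<^sub>p\<^sup>2 / \<gamma>\<^sub>p\<close> of its marginal density instead of \<open>f\<^sub>p\<close>. The index set of all variables is \<open>K\<close>.
\<close>

definition tilt_scale :: "(nat \<times> nat) set \<Rightarrow> (nat \<Rightarrow> nat \<Rightarrow> real) \<Rightarrow> nat \<Rightarrow> nat \<Rightarrow> real" where
  "tilt_scale D \<beta> i j = (if (i, j) \<in> D then 2 * \<beta> i j else \<beta> i j)"

definition tilt_mix :: "(nat \<times> nat) set \<Rightarrow> (nat \<Rightarrow> nat \<Rightarrow> nat \<Rightarrow> real) \<Rightarrow> nat \<Rightarrow> nat \<Rightarrow> nat \<Rightarrow> real" where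
  "tilt_mix D Q i j = (if (i, j) \<in> D then mix_V (Q i j) else Q i j)"

definition tilt_pdf :: "(nat \<times> nat) set \<Rightarrow> (nat \<times> nat) set \<Rightarrow> (nat \<Rightarrow> nat \<Rightarrow> real) \<Rightarrow>
    (nat \<Rightarrow> nat \<Rightarrow> nat \<Rightarrow> real) \<Rightarrow> (nat \<times> nat \<Rightarrow> real) \<Rightarrow> real" where
  "tilt_pdf K D \<beta> Q x = (\<Prod>(i, j)\<in>K. me_pdf (tilt_scale D \<beta> i j) (tilt_mix D Q i j) (x (i, j)))"

text \<open>
  An additional factor \<open>f\<^sub>p\<close> turns the marginal \<open>f\<^sub>p\<close> into its square, at the cost of a constant
  \<open>\<gamma>\<^sub>p\<close>.
\<close>

lemma tilt_pdf_insert: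
  assumes K: "finite K" "(a, s) \<in> K" "(a, s) \<notin> D" and *: "0 < \<beta> a s" "mixing_vector (Q a s)"
  shows "tilt_pdf K D \<beta> Q x * me_pdf (\<beta> a s) (Q a s) (x (a, s)) =
    me_gamma (\<beta> a s) (Q a s) * tilt_pdf K (insert (a, s) D) \<beta> Q x"
proof -
  let ?f = "\<lambda>D. \<lambda>(i, j). me_pdf (tilt_scale D \<beta> i j) (tilt_mix D Q i j) (x (i, j))"
  have rest: "(\<Prod>p\<in>K - {(a, s)}. ?f (insert (a, s) D) p) = (\<Prod>p\<in>K - {(a, s)}. ?f D p)"
  proof (rule prod.cong[OF refl])
    fix p assume "p \<in> K - {(a, s)}"
    thus "?f (insert (a, s) D) p = ?f D p" by (cases p) (auto simp: tilt_scale_def tilt_mix_def)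
  qed
  have "tilt_pdf K D \<beta> Q x * me_pdf (\<beta> a s) (Q a s) (x (a, s)) =
     (me_pdf (\<beta> a s) (Q a s) (x (a, s)) * me_pdf (\<beta> a s) (Q a s) (x (a, s))) * (\<Prod>p\<in>K - {(a, s)}. ?f D p)"
    unfolding tilt_pdf_def prod.remove[OF K(1,2)] using K(3)
    by (simp add: tilt_scale_def tilt_mix_def)
  also have "\<dots> = me_gamma (\<beta> a s) (Q a s) * (me_pdf (2 * \<beta> a s) (mix_V (Q a s)) (x (a, s)) * (\<Prod>p\<in>K - {(a, s)}. ?f (insert (a, s) D) p))"
    unfolding me_pdf_square[OF *] rest by simp
  also have "\<dots> = me_gamma (\<beta> a s) (Q a s) * tilt_pdf K (insert (a, s) D) \<beta> Q x"
    unfolding tilt_pdf_def prod.remove[OF K(1,2)] by (simp add: tilt_scale_def tilt_mix_def)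
  finally show ?thesis .
qed

text \<open>
  Each unordered pair of distinct variables occurs exactly once, so one sum over this set merges the
  sums within and between blocks.
\<close>

definition sme_pairs :: "nat \<Rightarrow> (nat \<Rightarrow> nat) \<Rightarrow> (nat \<times> nat \<times> nat \<times> nat) set" where
  "sme_pairs n k = (SIGMA a:{1..n}. SIGMA b:{a..n}. SIGMA s:{1..k a}. {sme_T s a b..k b})"

lemma finite_sme_pairs [simp]: "finite (sme_pairs n k)"
  by (simp add: sme_pairs_def)

lemma sum_sme_pairs:
  "(\<Sum>a=1..n. \<Sum>b=a..n. \<Sum>s=1..k a. \<Sum>t=sme_T s a b..k b. f a b s t) =
    (\<Sum>(a, b, s, t)\<in>sme_pairs n k. f a b s t)"
  by (simp add: sme_pairs_def sum.Sigma)

lemma sme_pairsD: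
  assumes "(a, b, s, t) \<in> sme_pairs n k"
  shows "(a, s) \<in> sme_index n k" "(b, t) \<in> sme_index n k" "(a, s) \<noteq> (b, t)"
  using assms by (auto simp: sme_pairs_def sme_index_def sme_T_def max_def split: if_splits)

lemma sme_bracket_eq:
  "sme_bracket n k \<beta> Q \<alpha> x = 1 + (\<Sum>(a, b, s, t)\<in>sme_pairs n k.
     \<alpha> a b s t * me_phi (\<beta> a s) (Q a s) (x (a, s)) * me_phi (\<beta> b t) (Q b t) (x (b, t)))"
proof -
  let ?f = "\<lambda>a b s t. \<alpha> a b s t * me_phi (\<beta> a s) (Q a s) (x (a, s)) * me_phi (\<beta> b t) (Q b t) (x (b, t))"
  have "(\<Sum>(a, b, s, t)\<in>sme_pairs n k. ?f a b s t) = (\<Sum>a=1..n. \<Sum>b=a..n. \<Sum>s=1..k a. \<Sum>t=sme_T s a b..k b. ?f a b s t)"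
    by (rule sum_sme_pairs[symmetric])
  also have "\<dots> = (\<Sum>a=1..n. (\<Sum>s=1..k a. \<Sum>t=s+1..k a. ?f a a s t) + (\<Sum>b=a+1..n. \<Sum>s=1..k a. \<Sum>t=1..k b. ?f a b s t))"
  proof (rule sum.cong[OF refl])
    fix a assume a: "a \<in> {1..n}"
    have "(\<Sum>b=a..n. \<Sum>s=1..k a. \<Sum>t=sme_T s a b..k b. ?f a b s t) =
      (\<Sum>s=1..k a. \<Sum>t=sme_T s a a..k a. ?f a a s t) + (\<Sum>b=a+1..n. \<Sum>s=1..k a. \<Sum>t=sme_T s a b..k b. ?f a b s t)"
      using a by (subst sum.atLeast_Suc_atMost) auto
    also have "(\<Sum>b=a+1..n. \<Sum>s=1..k a. \<Sum>t=sme_T s a b..k b. ?f a b s t) = (\<Sum>b=a+1..n. \<Sum>s=1..k a. \<Sum>t=1..k b. ?f a b s t)"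
      by (intro sum.cong) (auto simp: sme_T_def)
    finally show "(\<Sum>b=a..n. \<Sum>s=1..k a. \<Sum>t=sme_T s a b..k b. ?f a b s t) =
      (\<Sum>s=1..k a. \<Sum>t=s+1..k a. ?f a a s t) + (\<Sum>b=a+1..n. \<Sum>s=1..k a. \<Sum>t=1..k b. ?f a b s t)"
      by (simp add: sme_T_def)
  qed
  finally show ?thesis by (simp add: sme_bracket_def sum.distrib)
qed

text \<open>
  Expand each \<open>(f\<^sub>p - \<gamma>\<^sub>p) (f\<^sub>q - \<gamma>\<^sub>q)\<close> and absorb the extra factors \<open>f\<^sub>p\<close>, \<open>f\<^sub>q\<close> into the
  product of the marginal densities. The untilted terms collect to \<open>\<xi>\<close>.
\<close>

lemma sme_pdf_expansion:
  assumes br: "\<And>i j. i \<in> {1..n} \<Longrightarrow> j \<in> {1..k i} \<Longrightarrow> 0 < \<beta> i j \<and> mixing_vector (Q i j)"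
  defines "g \<equiv> \<lambda>D. tilt_pdf (sme_index n k) D \<beta> Q"
    and "\<gamma> \<equiv> \<lambda>i j. me_gamma (\<beta> i j) (Q i j)"
  shows "sme_pdf n k \<beta> Q \<alpha> x = sme_xi n k \<beta> Q \<alpha> * g {} x -
    (\<Sum>(a, b, s, t)\<in>sme_pairs n k. \<alpha> a b s t * \<gamma> a s * \<gamma> b t * (g {(a, s)} x + g {(b, t)} x - g {(a, s), (b, t)} x))"
proof -
  have fin: "finite (sme_index n k)" by (simp add: sme_index_def)
  have F: "(\<Prod>i=1..n. \<Prod>j=1..k i. me_pdf (\<beta> i j) (Q i j) (x (i, j))) = g {} x"
    by (simp add: g_def tilt_pdf_def tilt_scale_def tilt_mix_def sme_index_def prod.Sigma)
  have ins: "g D x * me_pdf (\<beta> a s) (Q a s) (x (a, s)) = \<gamma> a s * g (insert (a, s) D) x"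
    if "(a, s) \<in> sme_index n k" "(a, s) \<notin> D" for a s D
    unfolding g_def \<gamma>_def using that br by (intro tilt_pdf_insert fin) (auto simp: sme_index_def)
  have "g {} x * (me_phi (\<beta> a s) (Q a s) (x (a, s)) * me_phi (\<beta> b t) (Q b t) (x (b, t))) =
     \<gamma> a s * \<gamma> b t * (g {} x - g {(a, s)} x - g {(b, t)} x + g {(a, s), (b, t)} x)"
    if "(a, b, s, t) \<in> sme_pairs n k" for a b s t
  proof -
    note p = sme_pairsD[OF that]
    let ?u = "me_pdf (\<beta> a s) (Q a s) (x (a, s))" and ?v = "me_pdf (\<beta> b t) (Q b t) (x (b, t))"
    have 1: "g {} x * ?u = \<gamma> a s * g {(a, s)} x" "g {} x * ?v = \<gamma> b t * g {(b, t)} x"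
      using ins p by auto
    have "g {(b, t)} x * ?u = \<gamma> a s * g {(a, s), (b, t)} x"
      using ins p by auto
    moreover have "g {} x * ?u * ?v = \<gamma> b t * (g {(b, t)} x * ?u)"
      using 1(2) by simp
    ultimately have 2: "g {} x * ?u * ?v = \<gamma> a s * \<gamma> b t * g {(a, s), (b, t)} x"
      by simp
    have "g {} x * ((?u - \<gamma> a s) * (?v - \<gamma> b t)) = g {} x * ?u * ?v - \<gamma> b t * (g {} x * ?u)
      - \<gamma> a s * (g {} x * ?v) + \<gamma> a s * \<gamma> b t * g {} x"
      by (simp add: algebra_simps)
    also have "\<dots> = \<gamma> a s * \<gamma> b t * (g {} x - g {(a, s)} x - g {(b, t)} x + g {(a, s), (b, t)} x)"
      unfolding 2 unfolding 1 by (simp add: algebra_simps)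
    finally show ?thesis by (simp add: me_phi_def \<gamma>_def)
  qed
  note * = this
  have "sme_pdf n k \<beta> Q \<alpha> x = g {} x + (\<Sum>(a, b, s, t)\<in>sme_pairs n k.
     \<alpha> a b s t * (g {} x * (me_phi (\<beta> a s) (Q a s) (x (a, s)) * me_phi (\<beta> b t) (Q b t) (x (b, t)))))"
    unfolding sme_pdf_def F sme_bracket_eq
    by (simp add: ring_distribs sum_distrib_left case_prod_unfold mult_ac)
  also have "\<dots> = g {} x + (\<Sum>(a, b, s, t)\<in>sme_pairs n k.
     \<alpha> a b s t * \<gamma> a s * \<gamma> b t * g {} x - \<alpha> a b s t * \<gamma> a s * \<gamma> b t * (g {(a, s)} x + g {(b, t)} x - g {(a, s), (b, t)} x))"
  proof (intro arg_cong2[where f="(+)"] refl sum.cong, clarify)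
    fix a b s t assume "(a, b, s, t) \<in> sme_pairs n k"
    from *[OF this] show "\<alpha> a b s t * (g {} x * (me_phi (\<beta> a s) (Q a s) (x (a, s)) * me_phi (\<beta> b t) (Q b t) (x (b, t)))) =
      \<alpha> a b s t * \<gamma> a s * \<gamma> b t * g {} x - \<alpha> a b s t * \<gamma> a s * \<gamma> b t * (g {(a, s)} x + g {(b, t)} x - g {(a, s), (b, t)} x)"
      by (simp only:) (simp add: algebra_simps)
  qed
  also have "\<dots> = sme_xi n k \<beta> Q \<alpha> * g {} x -
    (\<Sum>(a, b, s, t)\<in>sme_pairs n k. \<alpha> a b s t * \<gamma> a s * \<gamma> b t * (g {(a, s)} x + g {(b, t)} x - g {(a, s), (b, t)} x))"
    unfolding sme_xi_def sum_sme_pairs \<gamma>_def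
    by (simp add: case_prod_unfold sum_subtractf ring_distribs sum_distrib_right)
  finally show ?thesis .
qed

lemma measure_density_eq_integral:
  fixes h :: "'a \<Rightarrow> real"
  assumes [measurable]: "h \<in> borel_measurable L" "A \<in> sets L" and h: "\<And>x. x \<in> space L \<Longrightarrow> 0 \<le> h x"
    and fin: "finite_measure (density L (\<lambda>x. ennreal (h x)))"
  shows "integrable L (\<lambda>x. h x * indicator A x)"
    "measure (density L (\<lambda>x. ennreal (h x))) A = (\<integral>x. h x * indicator A x \<partial>L)"
proof -
  interpret finite_measure "density L (\<lambda>x. ennreal (h x))" by (rule fin)
  have *: "(\<integral>\<^sup>+x. ennreal (h x * indicator A x) \<partial>L) = emeasure (density L (\<lambda>x. ennreal (h x))) A"
    by (subst emeasure_density) (auto intro!: nn_integral_cong simp: indicator_def)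
  show "integrable L (\<lambda>x. h x * indicator A x)"
    using h * by (intro integrableI_nonneg) (auto simp: less_top[symmetric])
  show "measure (density L (\<lambda>x. ennreal (h x))) A = (\<integral>x. h x * indicator A x \<partial>L)"
    using h * by (subst integral_eq_nn_integral) (auto simp: measure_def)
qed

lemma tilt_pdf_density:
  assumes K: "finite K" and br: "\<And>i j. (i, j) \<in> K \<Longrightarrow> 0 < \<beta> i j \<and> mixing_vector (Q i j)"
  shows "density (PiM K (\<lambda>_. lborel)) (\<lambda>x. ennreal (tilt_pdf K D \<beta> Q x)) =
      PiM K (\<lambda>(i, j). ME (tilt_scale D \<beta> i j) (tilt_mix D Q i j))"
    "0 \<le> tilt_pdf K D \<beta> Q x"
proof -
  let ?f = "\<lambda>p x. me_pdf (tilt_scale D \<beta> (fst p) (snd p)) (tilt_mix D Q (fst p) (snd p)) x"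
  have t: "0 < tilt_scale D \<beta> (fst p) (snd p)" "mixing_vector (tilt_mix D Q (fst p) (snd p))" if "p \<in> K" for p
    using br[of "fst p" "snd p"] that by (auto simp: tilt_scale_def tilt_mix_def mixing_vector_mix_V)
  have nn: "0 \<le> ?f p x" if "p \<in> K" for p x using t[OF that] by (rule me_pdf_nonneg)
  thus "0 \<le> tilt_pdf K D \<beta> Q x"
    unfolding tilt_pdf_def case_prod_unfold by (intro prod_nonneg) auto
  have "(\<lambda>x. ennreal (tilt_pdf K D \<beta> Q x)) = (\<lambda>x. \<Prod>p\<in>K. ennreal (?f p (x p)))"
    unfolding tilt_pdf_def case_prod_unfold using nn by (subst prod_ennreal) auto
  hence "density (PiM K (\<lambda>_. lborel)) (\<lambda>x. ennreal (tilt_pdf K D \<beta> Q x)) =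
    PiM K (\<lambda>p. density lborel (\<lambda>x. ennreal (?f p x)))"
    using K t by (simp only:) (rule density_PiM_lborel, auto intro!: prob_space.finite_measure prob_space_ME simp: ME_def[symmetric])
  thus "density (PiM K (\<lambda>_. lborel)) (\<lambda>x. ennreal (tilt_pdf K D \<beta> Q x)) =
      PiM K (\<lambda>(i, j). ME (tilt_scale D \<beta> i j) (tilt_mix D Q i j))"
    by (simp add: ME_def case_prod_unfold)
qed

lemma borel_measurable_tilt_pdf [measurable]: "tilt_pdf K D \<beta> Q \<in> borel_measurable (PiM K (\<lambda>_. lborel))"
  unfolding tilt_pdf_def case_prod_unfold by (intro borel_measurable_prod) measurable

text \<open>
  The expansion of the density integrated over an event. The individual terms may be negative, so the
  step from measures to integrals uses that the Sarmanov density itself is nonnegative everywhere: where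
  some coordinate is negative the marginal densities vanish, elsewhere the bracket is nonnegative.
\<close>

lemma SME_probability:
  assumes SME: "SME M n k \<beta> Q \<alpha> X" and A: "A \<in> sets (PiM (sme_index n k) (\<lambda>_. borel))"
  defines "N \<equiv> \<lambda>D. PiM (sme_index n k) (\<lambda>(i, j). ME (tilt_scale D \<beta> i j) (tilt_mix D Q i j))"
    and "\<gamma> \<equiv> \<lambda>i j. me_gamma (\<beta> i j) (Q i j)"
  shows "measure M {\<omega> \<in> space M. (\<lambda>(i, j)\<in>sme_index n k. X i j \<omega>) \<in> A} =
    sme_xi n k \<beta> Q \<alpha> * measure (N {}) A -
    (\<Sum>(a, b, s, t)\<in>sme_pairs n k. \<alpha> a b s t * \<gamma> a s * \<gamma> b t *
       (measure (N {(a, s)}) A + measure (N {(b, t)}) A - measure (N {(a, s), (b, t)}) A))"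
proof -
  let ?K = "sme_index n k"
  let ?L = "PiM ?K (\<lambda>_. lborel) :: (nat \<times> nat \<Rightarrow> real) measure"
  let ?Y = "\<lambda>\<omega>. \<lambda>(i, j)\<in>?K. X i j \<omega>" and ?h = "sme_pdf n k \<beta> Q \<alpha>"
  have fin: "finite ?K" by (simp add: sme_index_def)
  interpret prob_space M using SME by (simp add: SME_def)
  have br: "0 < \<beta> i j \<and> mixing_vector (Q i j)" if "i \<in> {1..n}" "j \<in> {1..k i}" for i j
    using SME that by (auto simp: SME_def)
  have brK: "0 < \<beta> i j \<and> mixing_vector (Q i j)" if "(i, j) \<in> ?K" for i j
    using br that by (auto simp: sme_index_def)
  have D: "distributed M ?L ?Y (\<lambda>x. ennreal (?h x))"
    using SME by (simp add: SME_def)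
  have "sets ?L = sets (PiM ?K (\<lambda>_. borel))" by (intro sets_PiM_cong) auto
  with A have AL [measurable]: "A \<in> sets ?L" by simp
  have exp: "?h x = sme_xi n k \<beta> Q \<alpha> * tilt_pdf ?K {} \<beta> Q x -
    (\<Sum>(a, b, s, t)\<in>sme_pairs n k. \<alpha> a b s t * \<gamma> a s * \<gamma> b t *
      (tilt_pdf ?K {(a, s)} \<beta> Q x + tilt_pdf ?K {(b, t)} \<beta> Q x - tilt_pdf ?K {(a, s), (b, t)} \<beta> Q x))" for x
    unfolding \<gamma>_def by (rule sme_pdf_expansion[OF br])
  have h [measurable]: "?h \<in> borel_measurable ?L"
    unfolding exp[abs_def] case_prod_unfold by measurable
  have nonneg: "0 \<le> ?h x" for x
  proof (cases "\<forall>p\<in>?K. 0 \<le> x p")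
    case True
    hence "0 \<le> sme_bracket n k \<beta> Q \<alpha> x" using SME by (simp add: SME_def)
    thus ?thesis unfolding sme_pdf_def using br
      by (intro mult_nonneg_nonneg prod_nonneg) (auto intro!: prod_nonneg me_pdf_nonneg)
  next
    case False
    then obtain i j where "i \<in> {1..n}" "j \<in> {1..k i}" "x (i, j) < 0" by (auto simp: sme_index_def not_le)
    hence "(\<Prod>j=1..k i. me_pdf (\<beta> i j) (Q i j) (x (i, j))) = 0"
      by (intro prod_zero bexI[of _ j]) (auto intro: me_pdf_neg)
    hence zero: "(\<Prod>i=1..n. \<Prod>j=1..k i. me_pdf (\<beta> i j) (Q i j) (x (i, j))) = 0"
      using \<open>i \<in> {1..n}\<close> by (metis (no_types, lifting) finite_atLeastAtMost prod_zero_iff)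
    show ?thesis unfolding sme_pdf_def zero by simp
  qed
  have dist: "distr M ?L ?Y = density ?L (\<lambda>x. ennreal (?h x))"
    using D by (rule distributed_distr_eq_density)
  have Y: "?Y \<in> measurable M ?L" using D by (rule distributed_measurable)
  have "prob_space (density ?L (\<lambda>x. ennreal (?h x)))"
    unfolding dist[symmetric] by (rule prob_space_distr[OF Y])
  note int_h = measure_density_eq_integral[OF h AL nonneg prob_space.finite_measure[OF this]]
  have N: "N D = density ?L (\<lambda>x. ennreal (tilt_pdf ?K D \<beta> Q x))" for D
    unfolding N_def using tilt_pdf_density(1)[OF fin brK] by simp
  have "prob_space (N D)" for D
    unfolding N_def using brK
    by (intro prob_space_PiM) (auto simp: tilt_scale_def tilt_mix_def intro!: prob_space_ME mixing_vector_mix_V)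
  hence finN: "finite_measure (density ?L (\<lambda>x. ennreal (tilt_pdf ?K D \<beta> Q x)))" for D
    unfolding N[symmetric] by (rule prob_space.finite_measure)
  note int_g = measure_density_eq_integral[OF borel_measurable_tilt_pdf AL tilt_pdf_density(2)[OF fin brK] finN]
  have mN: "measure (N D) A = (\<integral>x. tilt_pdf ?K D \<beta> Q x * indicator A x \<partial>?L)" for D
    unfolding N by (rule int_g(2))
  have "measure M {\<omega> \<in> space M. ?Y \<omega> \<in> A} = measure (distr M ?L ?Y) A"
    using Y AL by (subst measure_distr) (auto intro!: arg_cong[where f="measure M"])
  also have "\<dots> = (\<integral>x. ?h x * indicator A x \<partial>?L)"
    unfolding dist by (rule int_h(2))
  also have "\<dots> = (\<integral>x. sme_xi n k \<beta> Q \<alpha> * (tilt_pdf ?K {} \<beta> Q x * indicator A x) -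
      (\<Sum>(a, b, s, t)\<in>sme_pairs n k. \<alpha> a b s t * \<gamma> a s * \<gamma> b t * (tilt_pdf ?K {(a, s)} \<beta> Q x * indicator A x +
       tilt_pdf ?K {(b, t)} \<beta> Q x * indicator A x - tilt_pdf ?K {(a, s), (b, t)} \<beta> Q x * indicator A x)) \<partial>?L)"
    unfolding exp
    by (intro Bochner_Integration.integral_cong refl) (auto simp: indicator_def)
  also have "\<dots> = sme_xi n k \<beta> Q \<alpha> * measure (N {}) A -
    (\<Sum>(a, b, s, t)\<in>sme_pairs n k. \<alpha> a b s t * \<gamma> a s * \<gamma> b t *
       (measure (N {(a, s)}) A + measure (N {(b, t)}) A - measure (N {(a, s), (b, t)}) A))"
    unfolding mN case_prod_unfold
    by (simp add: int_g(1) Bochner_Integration.integral_diff Bochner_Integration.integral_sum)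
  finally show ?thesis .
qed

section \<open>Decomposition by the set of exceeded thresholds\<close>

lemma finite_increasing_lists [simp]: "finite (increasing_lists n m)"
  by (rule finite_subset[OF _ finite_lists_length_eq[of "{1..n}" m]]) (auto simp: increasing_lists_def)

lemma increasing_listsD:
  assumes "js \<in> increasing_lists n m"
  shows "length js = m" "distinct js" "set js \<subseteq> {1..n}" "sorted_list_of_set (set js) = js"
proof -
  show "length js = m" "set js \<subseteq> {1..n}" using assms by (auto simp: increasing_lists_def)
  have s: "sorted_wrt (<) js" using assms by (simp add: increasing_lists_def)
  thus "distinct js" by (simp add: strict_sorted_iff)
  show "sorted_list_of_set (set js) = js"
    using s by (simp add: sorted_list_of_set.idem_if_sorted_distinct strict_sorted_iff)
qed

lemma sorted_list_of_set_increasing: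
  assumes "J \<subseteq> {1..n}"
  shows "sorted_list_of_set J \<in> increasing_lists n (card J)"
  using assms finite_subset[OF assms] strict_sorted_list_of_set[of J] by (auto simp: increasing_lists_def)

text \<open>
  Sorted lists stand for sets of indices. The events for different sets are disjoint because each
  determines exactly which thresholds are exceeded.
\<close>

lemma stop_loss_decomposition:
  fixes S :: "nat \<Rightarrow> 'a \<Rightarrow> real"
  assumes "prob_space M" and [measurable]: "\<And>i. i \<in> {1..n} \<Longrightarrow> S i \<in> borel_measurable M" and y: "0 \<le> y"
  shows "measure M {\<omega> \<in> space M. (\<Sum>i=1..n. max 0 (S i \<omega> - d i)) \<le> y} =
    measure M {\<omega> \<in> space M. \<forall>i\<in>{1..n}. S i \<omega> \<le> d i} +
    (\<Sum>m=1..n. \<Sum>js\<in>increasing_lists n m. measure M {\<omega> \<in> space M. (\<forall>j\<in>set js. d j < S j \<omega>) \<and>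
       (\<forall>i\<in>{1..n} - set js. S i \<omega> \<le> d i) \<and> (\<Sum>j\<in>set js. S j \<omega> - d j) \<le> y})"
proof -
  interpret prob_space M by fact
  let ?J = "\<lambda>\<omega>. {i \<in> {1..n}. d i < S i \<omega>}"
  let ?Zero = "{\<omega> \<in> space M. \<forall>i\<in>{1..n}. S i \<omega> \<le> d i}"
  let ?E = "\<lambda>js. {\<omega> \<in> space M. (\<forall>j\<in>set js. d j < S j \<omega>) \<and>
       (\<forall>i\<in>{1..n} - set js. S i \<omega> \<le> d i) \<and> (\<Sum>j\<in>set js. S j \<omega> - d j) \<le> y}"
  let ?U = "SIGMA m:{1..n}. increasing_lists n m"
  have J: "?J \<omega> = set js"
    if "\<omega> \<in> ?E js" "js \<in> increasing_lists n m" for \<omega> js m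
    using that increasing_listsD(3)[OF that(2)] by (auto simp: not_le[symmetric])
  have R: "(\<Sum>i=1..n. max 0 (S i \<omega> - d i)) = (\<Sum>j\<in>?J \<omega>. S j \<omega> - d j)" for \<omega>
    by (rule sum.mono_neutral_cong_right) auto
  have E0: "?Zero \<in> sets M" by measurable
  have E: "?E js \<in> sets M" if "js \<in> increasing_lists n m" for js m
    using increasing_listsD(3)[OF that] by (intro sets.sets_Collect_conj sets.sets_Collect_finite_All) (auto simp: subset_iff)
  have split: "{\<omega> \<in> space M. (\<Sum>i=1..n. max 0 (S i \<omega> - d i)) \<le> y} = ?Zero \<union> (\<Union>u\<in>?U. ?E (snd u))"
  proof (intro equalityI subsetI)
    fix \<omega> assume "\<omega> \<in> {\<omega> \<in> space M. (\<Sum>i=1..n. max 0 (S i \<omega> - d i)) \<le> y}"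
    hence \<omega>: "\<omega> \<in> space M" "(\<Sum>j\<in>?J \<omega>. S j \<omega> - d j) \<le> y" unfolding R[symmetric] by blast+
    show "\<omega> \<in> ?Zero \<union> (\<Union>u\<in>?U. ?E (snd u))"
    proof (cases "?J \<omega> = {}")
      case True
      thus ?thesis using \<omega> by (auto simp: not_less)
    next
      case False
      have "card (?J \<omega>) \<le> card {1..n}" by (rule card_mono) auto
      hence c: "card (?J \<omega>) \<in> {1..n}" using False by (auto simp: Suc_le_eq card_gt_0_iff)
      have sub: "?J \<omega> \<subseteq> {1..n}" by blast
      have U: "(card (?J \<omega>), sorted_list_of_set (?J \<omega>)) \<in> ?U"
        using c sorted_list_of_set_increasing[OF sub] by (rule SigmaI)
      have set: "set (sorted_list_of_set (?J \<omega>)) = ?J \<omega>" by simp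
      have "\<omega> \<in> ?E (snd (card (?J \<omega>), sorted_list_of_set (?J \<omega>)))"
        unfolding snd_conv set using \<omega> by (auto simp: not_less)
      with U show ?thesis by (intro UnI2) (rule UN_I)
    qed
  next
    fix \<omega> assume "\<omega> \<in> ?Zero \<union> (\<Union>u\<in>?U. ?E (snd u))"
    thus "\<omega> \<in> {\<omega> \<in> space M. (\<Sum>i=1..n. max 0 (S i \<omega> - d i)) \<le> y}"
    proof
      assume \<omega>: "\<omega> \<in> ?Zero"
      hence "(\<Sum>i=1..n. max 0 (S i \<omega> - d i)) = 0" by (intro sum.neutral) auto
      thus ?thesis using \<omega> y by simp
    next
      assume "\<omega> \<in> (\<Union>u\<in>?U. ?E (snd u))"
      then obtain m js where js: "js \<in> increasing_lists n m" and \<omega>: "\<omega> \<in> ?E js" by auto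
      have "(\<Sum>i=1..n. max 0 (S i \<omega> - d i)) \<le> y" using \<omega> unfolding R J[OF \<omega> js] by blast
      thus ?thesis using \<omega> by blast
    qed
  qed
  have disj: "?Zero \<inter> (\<Union>u\<in>?U. ?E (snd u)) = {}"
  proof (rule equals0I)
    fix \<omega> assume \<omega>: "\<omega> \<in> ?Zero \<inter> (\<Union>u\<in>?U. ?E (snd u))"
    then obtain u where u: "u \<in> ?U" "\<omega> \<in> ?E (snd u)" by blast
    from u(1) have js: "snd u \<in> increasing_lists n (fst u)" and m: "1 \<le> fst u" by auto
    from \<omega> have "\<omega> \<in> ?Zero" by blast
    hence "?J \<omega> = {}" by (auto simp: not_less)
    with J[OF u(2) js] increasing_listsD(1)[OF js] m show False by simp
  qed
  have fam: "disjoint_family_on (\<lambda>u. ?E (snd u)) ?U"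
    unfolding disjoint_family_on_def
  proof (intro ballI impI equals0I)
    fix u v \<omega> assume uv: "u \<in> ?U" "v \<in> ?U" "u \<noteq> v" and \<omega>: "\<omega> \<in> ?E (snd u) \<inter> ?E (snd v)"
    from uv have js: "snd u \<in> increasing_lists n (fst u)" "snd v \<in> increasing_lists n (fst v)" by auto
    have "set (snd u) = set (snd v)"
      using J[OF IntD1[OF \<omega>] js(1)] J[OF IntD2[OF \<omega>] js(2)] by (rule trans[OF sym])
    hence "snd u = snd v" by (metis increasing_listsD(4) js)
    moreover from this have "fst u = fst v" by (metis increasing_listsD(1) js)
    ultimately show False using uv(3) by (simp add: prod_eq_iff)
  qed
  have Es: "?E (snd u) \<in> sets M" if "u \<in> ?U" for u
    by (rule E[of _ "fst u"]) (use that in auto)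
  have W: "(\<Union>u\<in>?U. ?E (snd u)) \<in> sets M"
    by (intro sets.finite_UN Es) simp
  have "measure M {\<omega> \<in> space M. (\<Sum>i=1..n. max 0 (S i \<omega> - d i)) \<le> y} = measure M ?Zero + (\<Sum>u\<in>?U. measure M (?E (snd u)))"
    unfolding split finite_measure_Union[OF E0 W disj]
  proof (intro arg_cong2[where f="(+)"] refl finite_measure_finite_Union fam)
    show "finite ?U" by simp
    show "(\<lambda>u. ?E (snd u)) ` ?U \<subseteq> sets M" using Es by blast
  qed
  also have "(\<Sum>u\<in>?U. measure M (?E (snd u))) = (\<Sum>m=1..n. \<Sum>js\<in>increasing_lists n m. measure M (?E js))"
    by (subst sum.Sigma) (auto simp: case_prod_unfold)
  finally show ?thesis .
qed

section \<open>Distribution function of the total excess\<close>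

theorem proposition3p4:
  fixes M :: "'a measure" and n :: nat and k :: "nat \<Rightarrow> nat"
    and \<beta> :: "nat \<Rightarrow> nat \<Rightarrow> real" and Q :: "nat \<Rightarrow> nat \<Rightarrow> nat \<Rightarrow> real"
    and \<alpha> :: "nat \<Rightarrow> nat \<Rightarrow> nat \<Rightarrow> nat \<Rightarrow> real"
    and X :: "nat \<Rightarrow> nat \<Rightarrow> 'a \<Rightarrow> real" and d :: "nat \<Rightarrow> real"
    and S T :: "nat \<Rightarrow> 'a \<Rightarrow> real" and R :: "'a \<Rightarrow> real"
    and B y :: real and \<gamma> :: "nat \<Rightarrow> nat \<Rightarrow> real"
  defines "S \<equiv> \<lambda>i \<omega>. \<Sum>j=1..k i. X i j \<omega>"
    and "T \<equiv> \<lambda>i \<omega>. max 0 (S i \<omega> - d i)"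
    and "R \<equiv> \<lambda>\<omega>. \<Sum>i=1..n. T i \<omega>"
    and "B \<equiv> 2 * \<beta> n (k n)"
    and "\<gamma> \<equiv> \<lambda>i j. me_gamma (\<beta> i j) (Q i j)"
  assumes "SME M n k \<beta> Q \<alpha> X"
    and "\<And>i j. i \<in> {1..n} \<Longrightarrow> j \<in> {1..k i} \<Longrightarrow>
           integrable (ME (\<beta> i j) (Q i j)) (me_pdf (\<beta> i j) (Q i j))"
    and "\<And>i j. i \<in> {1..n} \<Longrightarrow> j \<in> {1..k i} \<Longrightarrow> \<beta> i j \<le> \<beta> n (k n)"
    and "\<And>i. i \<in> {1..n} \<Longrightarrow> 0 < d i"
    and "0 \<le> y"
  shows "cdf (distr M borel R) y =
    measure M {\<omega> \<in> space M. \<forall>i\<in>{1..n}. S i \<omega> \<le> d i} +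
    (\<Sum>m=1..n. \<Sum>js\<in>increasing_lists n m.
       sme_xi n k \<beta> Q \<alpha> * me_H B (map (mix_S1 n k \<beta> Q) js) y (map d js)
         * (\<Prod>i\<in>{1..n} - set js. cdf (ME B (mix_S1 n k \<beta> Q i)) (d i))
       - (\<Sum>a=1..n. \<Sum>b=a..n. \<Sum>s=1..k a. \<Sum>t=sme_T s a b..k b.
            \<alpha> a b s t * \<gamma> a s * \<gamma> b t *
            (me_H B (map (mix_S2 n k \<beta> Q a s) js) y (map d js)
               * (\<Prod>i\<in>{1..n} - set js. cdf (ME B (mix_S2 n k \<beta> Q a s i)) (d i))
             + me_H B (map (mix_S2 n k \<beta> Q b t) js) y (map d js)
               * (\<Prod>i\<in>{1..n} - set js. cdf (ME B (mix_S2 n k \<beta> Q b t i)) (d i))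
             - me_H B (map (mix_S3 n k \<beta> Q a b s t) js) y (map d js)
               * (\<Prod>i\<in>{1..n} - set js. cdf (ME B (mix_S3 n k \<beta> Q a b s t i)) (d i)))))"
proof -
  note SME = assms(6) and scale = assms(8) and d = assms(9) and y = assms(10)
  interpret prob_space M using SME by (simp add: SME_def)
  let ?K = "sme_index n k"
  let ?N = "\<lambda>D. PiM ?K (\<lambda>(i, j). ME (tilt_scale D \<beta> i j) (tilt_mix D Q i j))"
  \<comment> \<open>The mixing vectors of all three kinds of auxiliary variables, indexed by the set of squared marginals.\<close>
  define P where "P = (\<lambda>D i. mix_Pi (\<lambda>l. mix_Psi (tilt_scale D \<beta> i l) B (tilt_mix D Q i l)) (k i))"
  have P_S1: "P {} = mix_S1 n k \<beta> Q"
    by (simp add: P_def mix_S1_def tilt_scale_def tilt_mix_def B_def fun_eq_iff)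
  have P_S3: "P {(a, s), (b, t)} = mix_S3 n k \<beta> Q a b s t" for a b s t
    unfolding P_def mix_S3_def tilt_scale_def tilt_mix_def scale_M_def mix_M_def B_def ..
  have P_S2: "P {(a, s)} = mix_S2 n k \<beta> Q a s" for a s
    using P_S3[of a s a s] by (simp add: mix_S2_def fun_eq_iff)
  have k: "1 \<le> k i" if "i \<in> {1..n}" for i using SME that by (simp add: SME_def)
  have br: "0 < \<beta> i j \<and> mixing_vector (Q i j)" if "i \<in> {1..n}" "j \<in> {1..k i}" for i j
    using SME that by (auto simp: SME_def)
  have tilt: "0 < tilt_scale D \<beta> i j \<and> tilt_scale D \<beta> i j \<le> B \<and> mixing_vector (tilt_mix D Q i j)"
    if "i \<in> {1..n}" "j \<in> {1..k i}" for D i j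
    using br[OF that] scale[OF that] by (auto simp: tilt_scale_def tilt_mix_def B_def mixing_vector_mix_V)
  have X [measurable]: "X i j \<in> borel_measurable M" if "i \<in> {1..n}" "j \<in> {1..k i}" for i j
  proof -
    have "distributed M lborel (X i j) (\<lambda>x. ennreal (me_pdf (\<beta> i j) (Q i j) x))"
      using SME that by (auto simp: SME_def)
    thus ?thesis by (auto dest: distributed_measurable)
  qed
  have S [measurable]: "S i \<in> borel_measurable M" if "i \<in> {1..n}" for i
    unfolding S_def using that by (intro borel_measurable_sum X)
  define H where "H = (\<lambda>D js. me_H B (map (P D) js) y (map d js) * (\<Prod>i\<in>{1..n} - set js. cdf (ME B (P D i)) (d i)))"
  have event: "measure M {\<omega> \<in> space M. (\<forall>j\<in>set js. d j < S j \<omega>) \<and>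
       (\<forall>i\<in>{1..n} - set js. S i \<omega> \<le> d i) \<and> (\<Sum>j\<in>set js. S j \<omega> - d j) \<le> y} =
     sme_xi n k \<beta> Q \<alpha> * H {} js - (\<Sum>(a, b, s, t)\<in>sme_pairs n k. \<alpha> a b s t * \<gamma> a s * \<gamma> b t *
       (H {(a, s)} js + H {(b, t)} js - H {(a, s), (b, t)} js))"
    if js: "js \<in> increasing_lists n m" and m: "m \<in> {1..n}" for js m
  proof -
    note inc = increasing_listsD[OF js]
    have ne: "js \<noteq> []" using inc(1) m by auto
    let ?A = "{x \<in> space (PiM ?K (\<lambda>_. borel)).
       (\<forall>j\<in>set js. d j < (\<Sum>l=1..k j. x (j, l))) \<and> (\<forall>i\<in>{1..n} - set js. (\<Sum>l=1..k i. x (i, l)) \<le> d i) \<and>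
       (\<Sum>j\<in>set js. (\<Sum>l=1..k j. x (j, l)) - d j) \<le> y}"
    have coord: "(\<lambda>x. x p) \<in> borel_measurable (PiM ?K (\<lambda>_. borel :: real measure))" if "p \<in> ?K" for p
      using that by (rule measurable_component_singleton)
    have block: "(\<lambda>x. \<Sum>l=1..k i. x (i, l) :: real) \<in> borel_measurable (PiM ?K (\<lambda>_. borel))" if "i \<in> {1..n}" for i
      using that by (intro borel_measurable_sum coord) (auto simp: sme_index_def)
    have A: "?A \<in> sets (PiM ?K (\<lambda>_. borel))"
      by (intro sets.sets_Collect_conj sets.sets_Collect_finite_All borel_measurable_le borel_measurable_less
          borel_measurable_sum borel_measurable_diff borel_measurable_const block) (use inc(3) in auto)
    have HD: "measure (?N D) ?A = H D js" for D
      unfolding H_def P_def sme_index_def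
      by (rule block_exceedance_probability)
         (use k tilt d inc ne in \<open>auto intro: less_imp_le\<close>)
    have eq: "(\<Sum>l=1..k i. (\<lambda>(i, j)\<in>?K. X i j \<omega>) (i, l)) = S i \<omega>" if "i \<in> {1..n}" for i \<omega>
      unfolding S_def using that by (intro sum.cong) (auto simp: sme_index_def)
    have "{\<omega> \<in> space M. (\<forall>j\<in>set js. d j < S j \<omega>) \<and>
       (\<forall>i\<in>{1..n} - set js. S i \<omega> \<le> d i) \<and> (\<Sum>j\<in>set js. S j \<omega> - d j) \<le> y} =
      {\<omega> \<in> space M. (\<lambda>(i, j)\<in>?K. X i j \<omega>) \<in> ?A}"
    proof -
      have sub: "j \<in> {1..n}" if "j \<in> set js" for j using inc(3) that by blast
      have "(\<lambda>(i, j)\<in>?K. X i j \<omega>) \<in> ?A \<longleftrightarrow> (\<forall>j\<in>set js. d j < S j \<omega>) \<and>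
       (\<forall>i\<in>{1..n} - set js. S i \<omega> \<le> d i) \<and> (\<Sum>j\<in>set js. S j \<omega> - d j) \<le> y" for \<omega>
      proof -
        let ?x = "\<lambda>(i, j)\<in>?K. X i j \<omega>"
        have "?x \<in> space (PiM ?K (\<lambda>_. borel))" by (auto simp: space_PiM)
        moreover have "(\<forall>j\<in>set js. d j < (\<Sum>l=1..k j. ?x (j, l))) \<longleftrightarrow> (\<forall>j\<in>set js. d j < S j \<omega>)"
          by (rule ball_cong[OF refl]) (simp only: eq[OF sub])
        moreover have "(\<forall>i\<in>{1..n} - set js. (\<Sum>l=1..k i. ?x (i, l)) \<le> d i) \<longleftrightarrow> (\<forall>i\<in>{1..n} - set js. S i \<omega> \<le> d i)"
          by (rule ball_cong[OF refl]) (simp only: eq[OF DiffD1])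
        moreover have "(\<Sum>j\<in>set js. (\<Sum>l=1..k j. ?x (j, l)) - d j) = (\<Sum>j\<in>set js. S j \<omega> - d j)"
          by (rule sum.cong[OF refl]) (simp only: eq[OF sub])
        ultimately show ?thesis by (simp only: mem_Collect_eq simp_thms)
      qed
      thus ?thesis by (simp only:)
    qed
    thus ?thesis
      using SME_probability[OF SME A] unfolding HD \<gamma>_def by simp
  qed
  have "cdf (distr M borel R) y = measure M {\<omega> \<in> space M. (\<Sum>i=1..n. max 0 (S i \<omega> - d i)) \<le> y}"
  proof -
    have "R \<in> borel_measurable M"
      unfolding R_def T_def by (intro borel_measurable_sum borel_measurable_max borel_measurable_diff S) auto
    thus ?thesis
      by (auto simp: cdf_def measure_distr R_def T_def intro!: arg_cong[where f="measure M"])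
  qed
  also have "\<dots> = measure M {\<omega> \<in> space M. \<forall>i\<in>{1..n}. S i \<omega> \<le> d i} +
    (\<Sum>m=1..n. \<Sum>js\<in>increasing_lists n m. measure M {\<omega> \<in> space M. (\<forall>j\<in>set js. d j < S j \<omega>) \<and>
       (\<forall>i\<in>{1..n} - set js. S i \<omega> \<le> d i) \<and> (\<Sum>j\<in>set js. S j \<omega> - d j) \<le> y})"
    by (rule stop_loss_decomposition[OF prob_space_axioms S y])
  also have "\<dots> = measure M {\<omega> \<in> space M. \<forall>i\<in>{1..n}. S i \<omega> \<le> d i} +
    (\<Sum>m=1..n. \<Sum>js\<in>increasing_lists n m. sme_xi n k \<beta> Q \<alpha> * H {} js -
      (\<Sum>(a, b, s, t)\<in>sme_pairs n k. \<alpha> a b s t * \<gamma> a s * \<gamma> b t *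
       (H {(a, s)} js + H {(b, t)} js - H {(a, s), (b, t)} js)))"
    by (intro arg_cong2[where f="(+)"] refl sum.cong event)
  finally show ?thesis
    unfolding H_def P_S1 P_S2 P_S3 sum_sme_pairs[symmetric] mult.assoc[of "sme_xi n k \<beta> Q \<alpha>"] .
qed

end
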